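(* Let $n\geq 1$ and $1\leq k\leq n$ be integers, let $\lambda_1,\ldots,\lambda_n>0$ and $\gamma>0$. Let $X_1,\ldots,X_n$ be independent exponential random variables with rates $\lambda_1,\ldots,\lambda_n$ respectively, and let $Y_1,\ldots,Y_n$ be independent exponential random variables with common rate $\gamma$. Let $X_{k:n}$ and $Y_{k:n}$ denote the $k$th order statistics of the two samples. Then the following three conditions are equivalent: (i) $\displaystyle \gamma\geq \left(\binom{n}{k}^{-1} s_k(\lambda_1,\ldots,\lambda_n)\right)^{1/k}$; (ii) $Y_{k:n}\leq_{\rm hr} X_{k:n}$; (iii) $Y_{k:n}\leq_{\rm disp} X_{k:n}$.
   Context: An exponential random variable with rate $\lambda>0$ has distribution function $1-e^{-\lambda x}$, $x\geq 0$. The $k$th order statistic of a sample of size $n$ is its $k$th smallest value (so $X_{1:n}$ is the minimum and $X_{n:n}$ the maximum). $s_k$ denotes the $k$th elementary symmetric function, $s_k(\lambda_1,\ldots,\lambda_n)=\sum_{1\leq i_1<\cdots<i_k\leq n}\lambda_{i_1}\cdots\lambda_{i_k}$. For random variables $U,V$ supported on $(0,\infty)$ with continuous distribution functions $F,G$ respectively: $U\leq_{\rm hr}V$ (hazard rate order) means that $(1-G(x))/(1-F(x))$ is increasing (in the weak sense) in $x>0$; $U\leq_{\rm disp}V$ (dispersive order) means that $F^{-1}(v)-F^{-1}(u)\leq G^{-1}(v)-G^{-1}(u)$ for all $0<u<v<1$, where $F^{-1},G^{-1}$ are the right continuous inverses. These orders depend only on the distributions of $U$ and $V$. *)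

theory Defs
  imports "HOL-Probability.Probability"
begin

definition elem_sym :: "nat \<Rightarrow> nat \<Rightarrow> (nat \<Rightarrow> real) \<Rightarrow> real" where
  "elem_sym n k a = (\<Sum>A | A \<subseteq> {1..n} \<and> card A = k. \<Prod>i\<in>A. a i)"

text \<open>
  Samples are indexed by \<open>{1..n}\<close> and \<open>k\<close> counts from 1 (meaningful for \<open>1 \<le> k \<le> n\<close>),
  whereas list access counts from 0.
\<close>

definition order_statistic :: "nat \<Rightarrow> nat \<Rightarrow> (nat \<Rightarrow> 'a \<Rightarrow> real) \<Rightarrow> 'a \<Rightarrow> real" where
  "order_statistic n k X \<omega> = sort (map (\<lambda>i. X i \<omega>) [1..<Suc n]) ! (k - 1)"

text \<open>
  The stochastic orders are relations between the distributions of the random variables, which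
  may therefore live on different probability spaces. They are intended for distributions that
  are supported on the positive half-line and have a continuous distribution function.

  In the hazard rate order the survival function of the larger variable is in the numerator. At
  points where the denominator vanishes the ratio is infinite or of the form \<open>0/0\<close> and imposes
  no condition; these points are excluded because division by zero yields 0 in HOL.
\<close>

definition hr_le :: "real measure \<Rightarrow> real measure \<Rightarrow> bool" where
  "hr_le \<mu> \<nu> \<longleftrightarrow>
     mono_on {x. 0 < x \<and> cdf \<mu> x < 1} (\<lambda>x. (1 - cdf \<nu> x) / (1 - cdf \<mu> x))"

text \<open>
  The strict inequality makes this the right continuous inverse of the distribution function.
\<close>

definition cdf_inv :: "real measure \<Rightarrow> real \<Rightarrow> real" where
  "cdf_inv \<mu> u = Inf {x. u < cdf \<mu> x}"

definition disp_le :: "real measure \<Rightarrow> real measure \<Rightarrow> bool" where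
  "disp_le \<mu> \<nu> \<longleftrightarrow>
     (\<forall>u v. 0 < u \<and> u < v \<and> v < 1 \<longrightarrow>
        cdf_inv \<mu> v - cdf_inv \<mu> u \<le> cdf_inv \<nu> v - cdf_inv \<nu> u)"

end

theory Submission
  imports Defs
begin

text \<open>
  Let \<open>F\<close> be the distribution function of the \<open>k\<close>th order statistic of the sample with rates
  \<open>r 1, \<dots>, r n\<close>, and \<open>H\<close>, \<open>h\<close> the distribution function and the density for rates that are all 1, so
  that \<open>H (\<gamma> * x)\<close> belongs to the common rate \<open>\<gamma>\<close>. At small times \<open>F x\<close> is asymptotic to
  \<open>s\<^sub>k * x ^ k\<close> with the elementary symmetric function \<open>s\<^sub>k\<close> of the rates. Each of the two orders
  implies \<open>F x \<le> H (\<gamma> * x)\<close> for all \<open>x > 0\<close>, and letting \<open>x\<close> tend to 0 gives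
  \<open>s\<^sub>k \<le> (n choose k) * \<gamma> ^ k\<close>, which is the first condition.

  For the converse let \<open>\<theta> x\<close> be the matched time, defined by \<open>H (\<theta> x) = F x\<close>. The heart of the
  matter is that \<open>\<theta> x / x\<close> decreases, or equivalently \<open>x * F' x \<le> \<theta> x * h (\<theta> x)\<close>
  (\<open>os_pdf_matched\<close>). Then \<open>\<theta> x / x\<close> is at most its limit at 0, and that is at most \<open>\<gamma>\<close> by the first
  condition; hence \<open>F' x \<le> \<gamma> * h (\<theta> x)\<close>. This says that \<open>\<theta> / \<gamma>\<close>, which carries the quantiles of the
  unequal sample to those of the equal one, has derivative at most 1, and that is the dispersive
  order. Together with \<open>\<theta> x \<le> \<gamma> * x\<close> and the fact that the hazard rate of \<open>H\<close> increases, it also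
  gives the hazard rate order.

  That \<open>\<theta> x / x\<close> decreases is proved by induction on \<open>k\<close>. After the first lifetime has ended, the
  rest of the sample contributes a \<open>(k - 1)\<close>th order statistic; thus \<open>F' = L * (G - F)\<close>, where \<open>L\<close> is
  the sum of the rates and \<open>G\<close> a mixture of distribution functions of \<open>(k - 1)\<close>th order statistics of
  smaller samples. Two facts make the induction work. First, \<open>s * h s\<close> is a concave function of
  \<open>H s\<close> (\<open>iid_tangent\<close>); the inequality can therefore be strengthened to the linear bound
  \<open>os_pdf_tangent\<close>, which passes to mixtures. Second, \<open>n * \<theta> x \<le> L * x\<close>, since replacing all rates by
  their mean makes it no less likely that \<open>k\<close> lifetimes have ended (\<open>os_cdf_le_iid_mean\<close>). With
  these, differentiating \<open>x * F' x - \<theta> x * h (\<theta> x)\<close> shows that this difference cannot increase where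
  it is positive; it tends to 0 at 0, so it is never positive (\<open>os_pdf_matched_step\<close>).
\<close>

section \<open>Numbers of successes in independent trials\<close>

text \<open>
  In independent trials with success probabilities \<open>p i\<close>, the summand that belongs to \<open>A\<close> is
  the probability that \<open>A\<close> is exactly the set of successes.
\<close>

definition tail_prob :: "nat \<Rightarrow> ('i \<Rightarrow> real) \<Rightarrow> 'i set \<Rightarrow> real" where
  "tail_prob k p S = (\<Sum>A | A \<subseteq> S \<and> k \<le> card A. (\<Prod>i\<in>A. p i) * (\<Prod>i\<in>S - A. 1 - p i))"

definition exact_prob :: "nat \<Rightarrow> ('i \<Rightarrow> real) \<Rightarrow> 'i set \<Rightarrow> real" where
  "exact_prob k p S = (\<Sum>A | A \<subseteq> S \<and> card A = k. (\<Prod>i\<in>A. p i) * (\<Prod>i\<in>S - A. 1 - p i))"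

text \<open>
  This conditions on the outcome of trial \<open>a\<close>. The truncated subtraction gives the right value
  at \<open>k = 0\<close>, because at least 0 successes are certain in every set of trials.
\<close>

lemma tail_prob_insert:
  assumes "finite S" "a \<notin> S"
  shows "tail_prob k p (insert a S) = p a * tail_prob (k - 1) p S + (1 - p a) * tail_prob k p S"
proof -
  let ?w = "\<lambda>T A. (\<Prod>i\<in>A. p i) * (\<Prod>i\<in>T - A. 1 - p i)"
  let ?U = "{A. A \<subseteq> S \<and> k \<le> card A}" and ?V = "{A. A \<subseteq> S \<and> k - 1 \<le> card A}"
  have fin: "finite A" if "A \<subseteq> S" for A using that assms finite_subset by blast
  have split: "{A. A \<subseteq> insert a S \<and> k \<le> card A} = ?U \<union> insert a ` ?V"
  proof (intro equalityI subsetI)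
    fix A assume A: "A \<in> {A. A \<subseteq> insert a S \<and> k \<le> card A}"
    show "A \<in> ?U \<union> insert a ` ?V"
    proof (cases "a \<in> A")
      case True
      then have "A - {a} \<subseteq> S" "k - 1 \<le> card (A - {a})" "A = insert a (A - {a})"
        using A by auto
      then show ?thesis by blast
    qed (use A in auto)
  next
    fix A assume "A \<in> ?U \<union> insert a ` ?V"
    then show "A \<in> {A. A \<subseteq> insert a S \<and> k \<le> card A}"
    proof
      assume "A \<in> insert a ` ?V"
      then obtain B where B: "B \<subseteq> S" "k - 1 \<le> card B" "A = insert a B" by auto
      moreover have "card A = Suc (card B)"
        using B fin[of B] assms by (metis card_insert_disjoint subsetD)
      ultimately show ?thesis by auto
    qed auto
  qed
  have "?U \<inter> insert a ` ?V = {}" using assms by auto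
  moreover have "finite ?U" "finite ?V" using assms by auto
  ultimately have "tail_prob k p (insert a S) = sum (?w (insert a S)) ?U + sum (?w (insert a S)) (insert a ` ?V)"
    unfolding tail_prob_def split by (intro sum.union_disjoint) auto
  also have "sum (?w (insert a S)) ?U = (\<Sum>A\<in>?U. (1 - p a) * ?w S A)"
  proof (intro sum.cong refl)
    fix A assume "A \<in> ?U"
    then have "insert a S - A = insert a (S - A)" using assms by auto
    then show "?w (insert a S) A = (1 - p a) * ?w S A" using assms by simp
  qed
  also have "sum (?w (insert a S)) (insert a ` ?V) = (\<Sum>A\<in>?V. p a * ?w S A)"
  proof -
    have inj: "inj_on (insert a) ?V" using assms by (intro inj_onI) (auto simp: insert_eq_iff)
    have "?w (insert a S) (insert a A) = p a * ?w S A" if "A \<in> ?V" for A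
    proof -
      have "insert a S - insert a A = S - A" "a \<notin> A" "finite A" using that assms fin by auto
      then show ?thesis by simp
    qed
    then show ?thesis by (subst sum.reindex[OF inj]) (auto simp: o_def intro: sum.cong)
  qed
  finally show ?thesis unfolding tail_prob_def by (simp add: sum_distrib_left)
qed

lemma tail_prob_remove:
  assumes "finite S" "a \<in> S"
  shows "tail_prob k p S = p a * tail_prob (k - 1) p (S - {a}) + (1 - p a) * tail_prob k p (S - {a})"
  using tail_prob_insert[of "S - {a}" a k p] assms by (simp add: insert_absorb)

lemma tail_prob_cong: "(\<And>i. i \<in> S \<Longrightarrow> p i = p' i) \<Longrightarrow> tail_prob k p S = tail_prob k p' S"
  unfolding tail_prob_def by (intro sum.cong refl arg_cong2[of _ _ _ _ "(*)"] prod.cong) auto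

lemma tail_prob_0: "finite S \<Longrightarrow> tail_prob 0 p S = 1"
  by (induction S rule: finite_induct) (simp_all add: tail_prob_insert, simp add: tail_prob_def)

lemma tail_prob_Suc:
  assumes "finite S"
  shows "tail_prob k p S = tail_prob (Suc k) p S + exact_prob k p S"
proof -
  have "{A. A \<subseteq> S \<and> k \<le> card A} = {A. A \<subseteq> S \<and> Suc k \<le> card A} \<union> {A. A \<subseteq> S \<and> card A = k}"
    by auto
  then show ?thesis unfolding tail_prob_def exact_prob_def
    by (simp only:) (intro sum.union_disjoint, use assms in auto)
qed

lemma exact_prob_nonneg:
  "(\<And>i. i \<in> S \<Longrightarrow> 0 \<le> p i \<and> p i \<le> 1) \<Longrightarrow> 0 \<le> exact_prob k p S"
  unfolding exact_prob_def by (intro sum_nonneg mult_nonneg_nonneg prod_nonneg) auto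

lemma exact_prob_pos:
  assumes "finite S" "k \<le> card S" "\<And>i. i \<in> S \<Longrightarrow> 0 < p i \<and> p i < 1"
  shows "0 < exact_prob k p S"
proof -
  obtain A where "A \<subseteq> S" "card A = k" using obtain_subset_with_card_n[OF assms(2)] by metis
  then have "{A. A \<subseteq> S \<and> card A = k} \<noteq> {}" by auto
  then show ?thesis unfolding exact_prob_def
    using assms by (intro sum_pos mult_pos_pos prod_pos) auto
qed

lemma exact_prob_const:
  fixes c :: real
  assumes "finite S"
  shows "exact_prob k (\<lambda>_. c) S = real (card S choose k) * c ^ k * (1 - c) ^ (card S - k)"
proof -
  have "exact_prob k (\<lambda>_. c) S = (\<Sum>A | A \<subseteq> S \<and> card A = k. c ^ k * (1 - c) ^ (card S - k))"
    unfolding exact_prob_def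
    using assms by (intro sum.cong refl) (auto simp: card_Diff_subset finite_subset)
  then show ?thesis using n_subsets[OF assms, of k] by simp
qed

lemma tail_prob_Suc_le:
  assumes "finite S" "\<And>i. i \<in> S \<Longrightarrow> 0 \<le> p i \<and> p i \<le> 1"
  shows "tail_prob (Suc k) p S \<le> tail_prob k p S"
  using tail_prob_Suc[OF assms(1), of k p] exact_prob_nonneg[of S p k] assms(2) by auto

lemma tail_prob_le_1:
  assumes "finite S" "\<And>i. i \<in> S \<Longrightarrow> 0 \<le> p i \<and> p i \<le> 1"
  shows "tail_prob k p S \<le> 1"
proof (induction k)
  case (Suc k)
  then show ?case using tail_prob_Suc_le[of S p k] assms by auto
qed (simp add: tail_prob_0 assms)

lemma tail_prob_ge_prod:
  assumes "finite S" "k \<le> card S" "\<And>i. i \<in> S \<Longrightarrow> 0 \<le> p i \<and> p i \<le> 1"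
  shows "(\<Prod>i\<in>S. p i) \<le> tail_prob k p S"
proof -
  have "(\<Prod>i\<in>S. p i) = (\<Sum>A\<in>{S}. (\<Prod>i\<in>A. p i) * (\<Prod>i\<in>S - A. 1 - p i))" by simp
  also have "\<dots> \<le> tail_prob k p S" unfolding tail_prob_def
    using assms by (intro sum_mono2 mult_nonneg_nonneg prod_nonneg) auto
  finally show ?thesis .
qed

lemma tail_prob_const:
  assumes "finite S" "finite T" "card S = card T"
  shows "tail_prob k (\<lambda>_. c) S = tail_prob k (\<lambda>_. c) T"
proof (induction k)
  case (Suc k)
  then show ?case using tail_prob_Suc[of S k "\<lambda>_. c"] tail_prob_Suc[of T k "\<lambda>_. c"]
    assms exact_prob_const[of S] exact_prob_const[of T] by simp
qed (simp add: tail_prob_0 assms)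

lemma one_minus_tail_prob:
  assumes "finite S"
  shows "1 - tail_prob k p S = (\<Sum>j<k. exact_prob j p S)"
proof (induction k)
  case (Suc k)
  then show ?case using tail_prob_Suc[OF assms, of k p] by simp
qed (simp add: tail_prob_0 assms)

section \<open>Order statistics of exponential lifetimes\<close>

text \<open>
  The \<open>k\<close>th smallest lifetime is at most \<open>x\<close> iff at least \<open>k\<close> of the lifetimes in \<open>S\<close> have ended
  by time \<open>x\<close>, and exponential lifetime \<open>i\<close> has done so with probability \<open>1 - exp (- r i * x)\<close>.
\<close>

definition os_cdf :: "nat \<Rightarrow> ('i \<Rightarrow> real) \<Rightarrow> 'i set \<Rightarrow> real \<Rightarrow> real" where
  "os_cdf k r S x = tail_prob k (\<lambda>i. 1 - exp (- (r i * x))) S"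

text \<open>
  By absence of memory, the \<open>k\<close>th order statistic is the sum of two independent parts: the
  minimum of the sample, which is exponential with rate \<open>sum r S\<close>, and the \<open>(k - 1)\<close>th order
  statistic of the sample without the member that ended first, which is \<open>i\<close> with probability
  proportional to \<open>r i\<close>. The formula below is the differential equation for the distribution
  function of this sum. It is the link between \<open>k\<close> and \<open>k - 1\<close> on which the later induction rests.
\<close>

definition os_pdf :: "nat \<Rightarrow> ('i \<Rightarrow> real) \<Rightarrow> 'i set \<Rightarrow> real \<Rightarrow> real" where
  "os_pdf k r S x = (\<Sum>i\<in>S. r i * (os_cdf (k - 1) r (S - {i}) x - os_cdf k r S x))"

lemma os_cdf_0: "finite S \<Longrightarrow> os_cdf 0 r S x = 1"
  by (simp add: os_cdf_def tail_prob_0)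

lemma os_pdf_0: "finite S \<Longrightarrow> os_pdf 0 r S x = 0"
  by (simp add: os_pdf_def os_cdf_0)

lemma os_cdf_insert:
  assumes "finite S" "a \<notin> S"
  shows "os_cdf k r (insert a S) x =
    (1 - exp (- (r a * x))) * os_cdf (k - 1) r S x + exp (- (r a * x)) * os_cdf k r S x"
  using tail_prob_insert[OF assms] by (simp add: os_cdf_def)

lemma os_cdf_remove:
  assumes "finite S" "a \<in> S"
  shows "os_cdf k r S x =
    (1 - exp (- (r a * x))) * os_cdf (k - 1) r (S - {a}) x + exp (- (r a * x)) * os_cdf k r (S - {a}) x"
  using tail_prob_remove[OF assms] by (simp add: os_cdf_def)

text \<open>
  Conditioning on one member of the sample expresses the distribution function through two
  smaller samples; the product rule then turns their derivatives into the required one.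
\<close>

lemma DERIV_os_cdf:
  assumes "finite S"
  shows "(os_cdf k r S has_real_derivative os_pdf k r S x) (at x)"
  using assms
proof (induction S arbitrary: k rule: finite_induct)
  case empty
  have "os_cdf k r {} = (\<lambda>_. os_cdf k r {} 0)" unfolding os_cdf_def by (intro ext tail_prob_cong) auto
  then show ?case by (metis DERIV_const os_pdf_def sum.empty)
next
  case (insert a S)
  let ?e = "exp (- (r a * x))"
  have e: "((\<lambda>x. exp (- (r a * x))) has_real_derivative - (r a * ?e)) (at x)"
    by (auto intro!: derivative_eq_intros)
  have "((\<lambda>x. (1 - exp (- (r a * x))) * os_cdf (k - 1) r S x + exp (- (r a * x)) * os_cdf k r S x)
      has_real_derivative ((0 - - (r a * ?e)) * os_cdf (k - 1) r S x + os_pdf (k - 1) r S x * (1 - ?e)) +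
        (- (r a * ?e) * os_cdf k r S x + os_pdf k r S x * ?e)) (at x)"
    by (intro DERIV_add DERIV_mult DERIV_diff DERIV_const e insert.IH)
  moreover have "os_cdf k r (insert a S) = (\<lambda>x. (1 - exp (- (r a * x))) * os_cdf (k - 1) r S x + exp (- (r a * x)) * os_cdf k r S x)"
    using os_cdf_insert[OF insert.hyps] by blast
  moreover have "((0 - - (r a * ?e)) * os_cdf (k - 1) r S x + os_pdf (k - 1) r S x * (1 - ?e)) +
        (- (r a * ?e) * os_cdf k r S x + os_pdf k r S x * ?e) = os_pdf k r (insert a S) x"
  proof -
    have rem: "os_cdf (k - 1) r (insert a S - {i}) x =
        (1 - ?e) * os_cdf (k - 1 - 1) r (S - {i}) x + ?e * os_cdf (k - 1) r (S - {i}) x"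
      if "i \<in> S" for i
    proof -
      have "insert a S - {i} = insert a (S - {i})" using that insert.hyps by auto
      then show ?thesis using os_cdf_insert[of "S - {i}" a "k - 1" r x] insert.hyps by simp
    qed
    have "os_pdf k r (insert a S) x = r a * (os_cdf (k - 1) r S x - os_cdf k r (insert a S) x)
       + (\<Sum>i\<in>S. r i * (os_cdf (k - 1) r (insert a S - {i}) x - os_cdf k r (insert a S) x))"
      using insert.hyps by (simp add: os_pdf_def)
    also have "(\<Sum>i\<in>S. r i * (os_cdf (k - 1) r (insert a S - {i}) x - os_cdf k r (insert a S) x))
      = (\<Sum>i\<in>S. (1 - ?e) * (r i * (os_cdf (k - 1 - 1) r (S - {i}) x - os_cdf (k - 1) r S x))
           + ?e * (r i * (os_cdf (k - 1) r (S - {i}) x - os_cdf k r S x)))"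
    proof (intro sum.cong refl)
      have alg: "\<rho> * (((1 - e) * A + e * B) - ((1 - e) * C + e * D)) = (1 - e) * (\<rho> * (A - C)) + e * (\<rho> * (B - D))"
        for \<rho> e A B C D :: real by (simp add: algebra_simps)
      show "r i * (os_cdf (k - 1) r (insert a S - {i}) x - os_cdf k r (insert a S) x) =
          (1 - ?e) * (r i * (os_cdf (k - 1 - 1) r (S - {i}) x - os_cdf (k - 1) r S x))
           + ?e * (r i * (os_cdf (k - 1) r (S - {i}) x - os_cdf k r S x))" if "i \<in> S" for i
        unfolding rem[OF that] os_cdf_insert[OF insert.hyps] by (rule alg)
    qed
    also have "\<dots> = (1 - ?e) * os_pdf (k - 1) r S x + ?e * os_pdf k r S x"
      by (simp add: os_pdf_def sum.distrib sum_distrib_left)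
    finally show ?thesis by (simp add: os_cdf_insert[OF insert.hyps] algebra_simps)
  qed
  ultimately show ?case by simp
qed

lemma DERIV_os_pdf:
  assumes "finite S"
  shows "(os_pdf k r S has_real_derivative
    (\<Sum>i\<in>S. r i * (os_pdf (k - 1) r (S - {i}) x - os_pdf k r S x))) (at x)"
proof -
  have "((\<lambda>x. \<Sum>i\<in>S. r i * (os_cdf (k - 1) r (S - {i}) x - os_cdf k r S x)) has_real_derivative
    (\<Sum>i\<in>S. r i * (os_pdf (k - 1) r (S - {i}) x - os_pdf k r S x))) (at x)"
    by (intro DERIV_sum DERIV_cmult DERIV_diff DERIV_os_cdf finite_Diff assms)
  then show ?thesis by (simp only: os_pdf_def[symmetric])
qed

lemma isCont_os_cdf: "finite S \<Longrightarrow> isCont (os_cdf k r S) x"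
  using DERIV_os_cdf DERIV_isCont by blast

text \<open>
  The density at \<open>x\<close> as the rate at which member \<open>i\<close> ends while exactly \<open>k - 1\<close> others have ended
  before. Unlike the difference formula, this form shows that it is positive.
\<close>

lemma os_pdf_eq_exact:
  assumes "finite S" "1 \<le> k"
  shows "os_pdf k r S x =
    (\<Sum>i\<in>S. r i * (exp (- (r i * x)) * exact_prob (k - 1) (\<lambda>i. 1 - exp (- (r i * x))) (S - {i})))"
  unfolding os_pdf_def
proof (intro sum.cong refl arg_cong2[of _ _ _ _ "(*)"])
  fix i assume "i \<in> S"
  then show "os_cdf (k - 1) r (S - {i}) x - os_cdf k r S x =
      exp (- (r i * x)) * exact_prob (k - 1) (\<lambda>i. 1 - exp (- (r i * x))) (S - {i})"
    using os_cdf_remove[of S i k r x] tail_prob_Suc[of "S - {i}" "k - 1" "\<lambda>i. 1 - exp (- (r i * x))"] assms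
    by (simp add: os_cdf_def algebra_simps)
qed

lemma os_pdf_pos:
  assumes "finite S" "1 \<le> k" "k \<le> card S" "\<forall>i\<in>S. 0 < r i" "0 < x"
  shows "0 < os_pdf k r S x"
  unfolding os_pdf_eq_exact[OF assms(1,2)]
  using assms by (intro sum_pos mult_pos_pos exact_prob_pos) auto

lemma os_cdf_at_0:
  assumes "finite S" "1 \<le> k"
  shows "os_cdf k r S 0 = 0"
proof -
  have "(\<Prod>i\<in>A. 0::real) = 0" if "k \<le> card A" "A \<subseteq> S" for A
    using that assms finite_subset[of A S] by (cases "A = {}") auto
  then show ?thesis unfolding os_cdf_def tail_prob_def by (intro sum.neutral) auto
qed

lemma os_cdf_strict_mono:
  assumes "finite S" "1 \<le> k" "k \<le> card S" "\<forall>i\<in>S. 0 < r i" "0 \<le> x" "x < y"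
  shows "os_cdf k r S x < os_cdf k r S y"
proof (rule DERIV_pos_imp_increasing_open[OF \<open>x < y\<close>])
  show "\<exists>D. (os_cdf k r S has_real_derivative D) (at t) \<and> 0 < D" if "x < t" "t < y" for t
    using DERIV_os_cdf[OF assms(1), of k r t] os_pdf_pos[OF assms(1-4), of t] that assms(5)
    by (intro exI[of _ "os_pdf k r S t"]) auto
  show "continuous_on {x..y} (os_cdf k r S)"
    by (intro continuous_at_imp_continuous_on ballI isCont_os_cdf assms)
qed

lemma os_cdf_less_iff:
  assumes "finite S" "1 \<le> k" "k \<le> card S" "\<forall>i\<in>S. 0 < r i" "0 \<le> x" "0 \<le> y"
  shows "os_cdf k r S x < os_cdf k r S y \<longleftrightarrow> x < y"
  using os_cdf_strict_mono[OF assms(1-4), of x y] os_cdf_strict_mono[OF assms(1-4), of y x] assms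
  by (cases x y rule: linorder_cases) auto

lemma os_cdf_le_iff:
  assumes "finite S" "1 \<le> k" "k \<le> card S" "\<forall>i\<in>S. 0 < r i" "0 \<le> x" "0 \<le> y"
  shows "os_cdf k r S x \<le> os_cdf k r S y \<longleftrightarrow> x \<le> y"
  using os_cdf_less_iff[OF assms(1-4), of y x] assms by auto

lemma os_cdf_le_1:
  assumes "finite S" "\<forall>i\<in>S. 0 < r i" "0 \<le> x"
  shows "os_cdf k r S x \<le> 1"
  unfolding os_cdf_def using assms by (intro tail_prob_le_1) (auto simp: less_imp_le)

lemma os_cdf_less_1:
  assumes "finite S" "1 \<le> k" "k \<le> card S" "\<forall>i\<in>S. 0 < r i" "0 \<le> x"
  shows "os_cdf k r S x < 1"
  using os_cdf_strict_mono[OF assms(1-5), of "x + 1"] os_cdf_le_1[OF assms(1,4), of "x + 1" k] assms(5)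
  by auto

lemma os_cdf_pos:
  assumes "finite S" "1 \<le> k" "k \<le> card S" "\<forall>i\<in>S. 0 < r i" "0 < x"
  shows "0 < os_cdf k r S x"
  using os_cdf_strict_mono[OF assms(1-4), of 0 x] os_cdf_at_0[OF assms(1,2), of r] assms(5) by simp

lemma os_cdf_surj:
  assumes "finite S" "1 \<le> k" "k \<le> card S" "\<forall>i\<in>S. 0 < r i" "0 < v" "v < 1"
  shows "\<exists>x>0. os_cdf k r S x = v"
proof -
  \<comment> \<open>The distribution function is at least the probability that all lifetimes have ended, which tends to 1.\<close>
  have "((\<lambda>x. \<Prod>i\<in>S. 1 - exp (- (r i * x))) \<longlongrightarrow> (\<Prod>i\<in>S. 1 - 0)) at_top"
  proof (intro tendsto_prod tendsto_diff tendsto_const)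
    fix i assume "i \<in> S"
    then have "0 < r i" using assms by auto
    then show "((\<lambda>x. exp (- (r i * x))) \<longlongrightarrow> 0) at_top" by real_asymp
  qed
  then have "\<forall>\<^sub>F x in at_top. v < (\<Prod>i\<in>S. 1 - exp (- (r i * x)))"
    using assms(6) by (intro order_tendstoD(1)) auto
  then have "\<forall>\<^sub>F x in at_top. 0 < x \<and> v < (\<Prod>i\<in>S. 1 - exp (- (r i * x)))"
    by (intro eventually_conj eventually_gt_at_top)
  then obtain b where b: "0 < b" "v < (\<Prod>i\<in>S. 1 - exp (- (r i * b)))"
    using eventually_happens[of _ "at_top :: real filter"] by auto
  have "(\<Prod>i\<in>S. 1 - exp (- (r i * b))) \<le> os_cdf k r S b"
    unfolding os_cdf_def using assms b by (intro tail_prob_ge_prod) (auto simp: less_imp_le)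
  then have "\<exists>x\<ge>0. x \<le> b \<and> os_cdf k r S x = v"
    using b assms os_cdf_at_0[OF assms(1,2), of r] by (intro IVT allI impI isCont_os_cdf) auto
  then obtain x where "0 \<le> x" "os_cdf k r S x = v" by auto
  moreover have "x \<noteq> 0" using calculation os_cdf_at_0[OF assms(1,2), of r] assms(5) by auto
  ultimately show ?thesis by (intro exI[of _ x]) auto
qed

section \<open>Comparison with the mean rate\<close>

text \<open>
  The dependence on two of the trials, in terms of the sum of their success probabilities and the
  product of their failure probabilities. Averaging two exponential rates leaves that product
  unchanged, so that only the first term matters for it.
\<close>

lemma tail_prob_pair:
  assumes "finite S" "a \<in> S" "b \<in> S" "a \<noteq> b"
  shows "tail_prob k p S =
    (p a + p b) * (tail_prob (k - 2) p (S - {a, b}) - tail_prob (k - 1) p (S - {a, b}))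
    + (1 - p a) * (1 - p b) * (tail_prob (k - 2) p (S - {a, b}) + tail_prob k p (S - {a, b})
        - 2 * tail_prob (k - 1) p (S - {a, b}))
    + 2 * tail_prob (k - 1) p (S - {a, b}) - tail_prob (k - 2) p (S - {a, b})"
proof -
  have *: "S - {a} - {b} = S - {a, b}" by auto
  have **: "tail_prob m p (S - {a}) = p b * tail_prob (m - 1) p (S - {a, b})
      + (1 - p b) * tail_prob m p (S - {a, b})" for m
    using tail_prob_remove[of "S - {a}" b m p] assms by (simp add: *)
  have k2: "k - 1 - 1 = k - 2" by simp
  show ?thesis
    unfolding tail_prob_remove[OF assms(1,2), of k p] ** k2 by (simp only: algebra_simps)
qed

lemma tail_prob_smooth:
  assumes "finite S" "a \<in> S" "b \<in> S" "a \<noteq> b"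
    and "\<And>i. i \<in> S - {a, b} \<Longrightarrow> p i = p' i \<and> 0 \<le> p i \<and> p i \<le> 1"
    and "(1 - p a) * (1 - p b) = (1 - p' a) * (1 - p' b)" "p a + p b \<le> p' a + p' b"
  shows "tail_prob k p S \<le> tail_prob k p' S"
proof -
  let ?T = "\<lambda>m. tail_prob m p (S - {a, b})"
  have eq: "tail_prob m p' (S - {a, b}) = ?T m" for m
    by (rule tail_prob_cong) (use assms(5) in auto)
  have "?T (k - 1) \<le> ?T (k - 2)"
  proof (cases "k \<le> 1")
    case False
    then have "k - 1 = Suc (k - 2)" by simp
    moreover have "\<forall>i\<in>S - {a, b}. 0 \<le> p i \<and> p i \<le> 1" using assms(5) by blast
    ultimately show ?thesis using tail_prob_Suc_le[of "S - {a, b}" p "k - 2"] assms(1) by auto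
  qed (auto simp: le_Suc_eq)
  then have "(p a + p b) * (?T (k - 2) - ?T (k - 1)) \<le> (p' a + p' b) * (?T (k - 2) - ?T (k - 1))"
    using assms(7) by (intro mult_right_mono) auto
  then show ?thesis
    unfolding tail_prob_pair[OF assms(1-4)] eq assms(6) by simp
qed

text \<open>
  Robin Hood transfers: as long as the \<open>c i\<close> are not all equal to their mean \<open>\<mu>\<close>, some \<open>c a\<close> lies
  below and some \<open>c b\<close> above. Replacing the two by \<open>\<mu>\<close> and \<open>c a + c b - \<mu>\<close> keeps the sum, does
  not decrease the probability, and leaves fewer values different from \<open>\<mu>\<close>.
\<close>

lemma tail_prob_le_mean:
  fixes c :: "'i \<Rightarrow> real" and \<mu> :: real
  assumes "finite S" "\<forall>i\<in>S. 0 \<le> c i" "sum c S = card S * \<mu>" "0 \<le> \<mu>"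
  shows "tail_prob k (\<lambda>i. 1 - exp (- c i)) S \<le> tail_prob k (\<lambda>_. 1 - exp (- \<mu>)) S"
  using assms(2,3)
proof (induction "card {i \<in> S. c i \<noteq> \<mu>}" arbitrary: c rule: less_induct)
  case less
  show ?case
  proof (cases "\<forall>i\<in>S. c i = \<mu>")
    case True
    then show ?thesis by (intro eq_refl tail_prob_cong) auto
  next
    case False
    have sum0: "(\<Sum>i\<in>S. c i - \<mu>) = 0" using less.prems by (simp add: sum_subtractf)
    have "\<exists>a\<in>S. c a < \<mu>"
    proof (rule ccontr)
      assume "\<not> (\<exists>a\<in>S. c a < \<mu>)"
      then have "\<forall>i\<in>S. c i - \<mu> = 0"
        using sum_nonneg_eq_0_iff[OF assms(1), of "\<lambda>i. c i - \<mu>"] sum0 by (simp add: not_less)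
      then show False using False by auto
    qed
    moreover have "\<exists>b\<in>S. \<mu> < c b"
    proof (rule ccontr)
      assume "\<not> (\<exists>b\<in>S. \<mu> < c b)"
      moreover have "(\<Sum>i\<in>S. \<mu> - c i) = 0" using sum0 by (simp add: sum_subtractf)
      ultimately have "\<forall>i\<in>S. \<mu> - c i = 0"
        using sum_nonneg_eq_0_iff[OF assms(1), of "\<lambda>i. \<mu> - c i"] by (simp add: not_less)
      then show False using False by auto
    qed
    ultimately obtain a b where ab: "a \<in> S" "c a < \<mu>" "b \<in> S" "\<mu> < c b" "a \<noteq> b" by fastforce
    define d where "d = c(a := \<mu>, b := c a + c b - \<mu>)"
    have d: "d a = \<mu>" "d b = c a + c b - \<mu>" "\<And>i. i \<noteq> a \<Longrightarrow> i \<noteq> b \<Longrightarrow> d i = c i"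
      using ab by (auto simp: d_def)
    have "tail_prob k (\<lambda>i. 1 - exp (- c i)) S \<le> tail_prob k (\<lambda>i. 1 - exp (- d i)) S"
    proof (rule tail_prob_smooth[OF assms(1) ab(1,3,5)])
      show "(1 - (1 - exp (- c a))) * (1 - (1 - exp (- c b))) = (1 - (1 - exp (- d a))) * (1 - (1 - exp (- d b)))"
        by (simp add: d exp_add[symmetric])
      \<comment> \<open>This is convexity of the exponential function, in factored form.\<close>
      have "0 \<le> (exp (- c a) - exp (- \<mu>)) * (1 - exp (\<mu> - c b))"
        using ab by (intro mult_nonneg_nonneg) auto
      also have "\<dots> = exp (- c a) + exp (- c b) - exp (- \<mu>) - exp (- (c a + c b - \<mu>))"
        by (simp add: algebra_simps exp_add[symmetric])
      finally show "1 - exp (- c a) + (1 - exp (- c b)) \<le> 1 - exp (- d a) + (1 - exp (- d b))"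
        by (simp add: d)
      show "1 - exp (- c i) = 1 - exp (- d i) \<and> 0 \<le> 1 - exp (- c i) \<and> 1 - exp (- c i) \<le> 1"
        if "i \<in> S - {a, b}" for i
        using that less.prems d by auto
    qed
    also have "\<dots> \<le> tail_prob k (\<lambda>_. 1 - exp (- \<mu>)) S"
    proof (rule less.hyps)
      have "{i \<in> S. d i \<noteq> \<mu>} \<subseteq> {i \<in> S. c i \<noteq> \<mu>} - {a}"
        using ab by (auto simp: d_def split: if_splits)
      moreover have "a \<in> {i \<in> S. c i \<noteq> \<mu>}" using ab by auto
      ultimately have "{i \<in> S. d i \<noteq> \<mu>} \<subset> {i \<in> S. c i \<noteq> \<mu>}" by blast
      then show "card {i \<in> S. d i \<noteq> \<mu>} < card {i \<in> S. c i \<noteq> \<mu>}"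
        using assms(1) by (intro psubset_card_mono) auto
      show "\<forall>i\<in>S. 0 \<le> d i" using less.prems ab assms(4) by (auto simp: d_def)
      have *: "sum f S = f a + f b + sum f (S - {a, b})" for f :: "'i \<Rightarrow> real"
      proof -
        have "S - {a} - {b} = S - {a, b}" by auto
        then show ?thesis
          using ab assms(1) sum.remove[of S a f] sum.remove[of "S - {a}" b f] by simp
      qed
      have "sum d (S - {a, b}) = sum c (S - {a, b})" by (intro sum.cong refl d(3)) auto
      then have "sum d S = sum c S" unfolding *[of c] *[of d] by (simp add: d)
      then show "sum d S = card S * \<mu>" using less.prems by simp
    qed
    finally show ?thesis .
  qed
qed

section \<open>Equal rates\<close>

text \<open>
  Rate 1 suffices: a common rate \<open>c\<close> only rescales time by \<open>c\<close>, as \<open>os_cdf_const\<close> states.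
\<close>

definition iid_cdf :: "nat \<Rightarrow> nat \<Rightarrow> real \<Rightarrow> real" where
  "iid_cdf n k = os_cdf k (\<lambda>_. 1) {..<n}"

definition iid_pdf :: "nat \<Rightarrow> nat \<Rightarrow> real \<Rightarrow> real" where
  "iid_pdf n k t = real k * real (n choose k) * (1 - exp (- t)) ^ (k - 1) * exp (- t) ^ (n - k + 1)"

lemma os_cdf_const:
  assumes "finite S"
  shows "os_cdf k (\<lambda>_. c) S x = iid_cdf (card S) k (c * x)"
  unfolding os_cdf_def iid_cdf_def by (simp add: tail_prob_const[of S "{..<card S}"] assms)

lemma os_cdf_le_iid_mean:
  assumes "finite S" "S \<noteq> {}" "\<forall>i\<in>S. 0 < r i" "0 \<le> x"
  shows "os_cdf k r S x \<le> iid_cdf (card S) k (sum r S * x / card S)"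
proof -
  have "os_cdf k r S x \<le> tail_prob k (\<lambda>_. 1 - exp (- (sum r S * x / card S))) S"
    unfolding os_cdf_def
  proof (rule tail_prob_le_mean[OF assms(1)])
    show "\<forall>i\<in>S. 0 \<le> r i * x" using assms by (auto intro: mult_nonneg_nonneg less_imp_le)
    show "(\<Sum>i\<in>S. r i * x) = card S * (sum r S * x / card S)"
      using assms by (simp add: sum_distrib_right)
    show "0 \<le> sum r S * x / card S"
      using assms by (intro divide_nonneg_nonneg mult_nonneg_nonneg sum_nonneg) (auto intro: less_imp_le)
  qed
  also have "\<dots> = iid_cdf (card S) k (sum r S * x / card S)"
    unfolding iid_cdf_def os_cdf_def by (simp add: tail_prob_const[of S "{..<card S}"] assms)
  finally show ?thesis .
qed

lemma iid_cdf_0: "iid_cdf n 0 x = 1"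
  by (simp add: iid_cdf_def os_cdf_0)

lemma iid_pdf_0: "iid_pdf n 0 x = 0"
  by (simp add: iid_pdf_def)

lemma iid_pdf_eq_os_pdf:
  assumes "k \<le> n"
  shows "iid_pdf n k t = os_pdf k (\<lambda>_. 1) {..<n} t"
proof (cases "k = 0")
  case True
  then show ?thesis by (simp add: iid_pdf_0 os_pdf_0)
next
  case False
  then obtain m where m: "n = Suc m" "k - 1 \<le> m" using assms by (cases n) auto
  have "os_pdf k (\<lambda>_. 1) {..<n} t = (\<Sum>i<n. exp (- t) * (real (m choose (k - 1)) * (1 - exp (- t)) ^ (k - 1) * exp (- t) ^ (m - (k - 1))))"
    using False m by (subst os_pdf_eq_exact) (auto simp: exact_prob_const intro!: sum.cong)
  also have "\<dots> = (real n * real (m choose (k - 1))) * (1 - exp (- t)) ^ (k - 1) * exp (- t) ^ (n - k + 1)"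
    using m False by (simp add: Suc_diff_le)
  also have "real n * real (m choose (k - 1)) = real k * real (n choose k)"
    using times_binomial_minus1_eq[of k n] False m by (metis diff_Suc_1 neq0_conv of_nat_mult)
  finally show ?thesis unfolding iid_pdf_def by simp
qed

lemma iid_pdf_eq_diff:
  assumes "k \<le> n"
  shows "iid_pdf n k t = n * (iid_cdf (n - 1) (k - 1) t - iid_cdf n k t)"
proof -
  have "os_cdf (k - 1) (\<lambda>_. 1) ({..<n} - {i}) t = iid_cdf (n - 1) (k - 1) t" if "i < n" for i
    using that os_cdf_const[of "{..<n} - {i}" "k - 1" 1 t] by simp
  then show ?thesis
    unfolding iid_pdf_eq_os_pdf[OF assms] os_pdf_def by (simp add: iid_cdf_def)
qed

lemma DERIV_iid_cdf: "k \<le> n \<Longrightarrow> (iid_cdf n k has_real_derivative iid_pdf n k t) (at t)"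
  unfolding iid_cdf_def iid_pdf_eq_os_pdf by (rule DERIV_os_cdf) simp

lemma iid_pdf_pos: "1 \<le> k \<Longrightarrow> k \<le> n \<Longrightarrow> 0 < t \<Longrightarrow> 0 < iid_pdf n k t"
  unfolding iid_pdf_def by (intro mult_pos_pos zero_less_power) auto

text \<open>
  The generating function of the Bernoulli numbers, which enters through the logarithmic derivative
  of \<open>1 - exp (- t)\<close>.
\<close>

definition bernoulli_fun :: "real \<Rightarrow> real" where
  "bernoulli_fun t = t / (exp t - 1)"

text \<open>
  This is \<open>t * h' t / h t\<close> for the density \<open>h = iid_pdf n k\<close>. The formula is also used at \<open>k = 0\<close>,
  where \<open>h\<close> vanishes and the elasticity is a convention. It is chosen so that
  \<open>iid_elasticity_pred\<close> holds down to \<open>k = 1\<close>.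
\<close>

definition iid_elasticity :: "nat \<Rightarrow> nat \<Rightarrow> real \<Rightarrow> real" where
  "iid_elasticity n k t = (real k - 1) * bernoulli_fun t - (real n - real k + 1) * t"

lemma bernoulli_fun_bounds:
  assumes "0 < t"
  shows "0 < bernoulli_fun t" "bernoulli_fun t \<le> 1" "1 - t \<le> bernoulli_fun t"
proof -
  have e: "t \<le> exp t - 1" using exp_ge_add_one_self[of t] by linarith
  then show "0 < bernoulli_fun t" "bernoulli_fun t \<le> 1"
    using assms by (auto simp: bernoulli_fun_def)
  have "exp t * (1 - t) \<le> exp t * exp (- t)"
    using exp_ge_add_one_self[of "- t"] by (intro mult_left_mono) auto
  then have "(1 - t) * (exp t - 1) \<le> t" by (simp add: exp_minus algebra_simps)
  then show "1 - t \<le> bernoulli_fun t"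
    using e assms by (simp add: bernoulli_fun_def pos_le_divide_eq)
qed

lemma bernoulli_fun_antimono:
  assumes "0 < s" "s \<le> t"
  shows "bernoulli_fun t \<le> bernoulli_fun s"
proof -
  have "exp ((1 - s / t) *\<^sub>R 0 + (s / t) *\<^sub>R t) \<le> (1 - s / t) * exp 0 + (s / t) * exp t"
    using assms by (intro convex_onD[OF exp_convex]) auto
  then have "exp s \<le> 1 - s / t + s / t * exp t" using assms by simp
  then have "t * (exp s - 1) \<le> t * (s / t * (exp t - 1))"
    using assms by (intro mult_left_mono) (auto simp: algebra_simps)
  then have "t * (exp s - 1) \<le> s * (exp t - 1)" using assms by simp
  moreover have "0 < exp s - 1" "0 < exp t - 1" using assms by auto
  ultimately show ?thesis unfolding bernoulli_fun_def by (simp add: frac_le_eq divide_le_eq field_simps)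
qed

lemma iid_elasticity_antimono:
  assumes "1 \<le> k" "k \<le> n" "0 < s" "s \<le> t"
  shows "iid_elasticity n k t \<le> iid_elasticity n k s"
  unfolding iid_elasticity_def using assms bernoulli_fun_antimono[OF assms(3,4)]
  by (intro diff_mono mult_left_mono) auto

lemma iid_elasticity_pred:
  assumes "1 \<le> k" "1 \<le> n"
  shows "iid_elasticity (n - 1) (k - 1) t = iid_elasticity n k t - bernoulli_fun t"
  using assms by (simp add: iid_elasticity_def of_nat_diff algebra_simps)

lemma DERIV_iid_pdf:
  assumes "k \<le> n" "0 < t"
  shows "(iid_pdf n k has_real_derivative iid_elasticity n k t * iid_pdf n k t / t) (at t)"
proof (cases "k = 0")
  case True
  then show ?thesis using DERIV_const[of 0] by (simp add: iid_pdf_0[abs_def])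
next
  case False
  let ?p = "1 - exp (- t)" and ?c = "real k * real (n choose k)"
  have alg: "c * (l * (P / q) * e) * E - c * P * (m * E) = (l * (e / q) - m) * (c * P * E)"
    for c l P q e E m :: real by (simp add: algebra_simps)
  have p: "0 < ?p" using assms by simp
  have b: "bernoulli_fun t / t = exp (- t) / ?p"
    using assms by (simp add: bernoulli_fun_def exp_minus field_simps)
  have "(iid_pdf n k has_real_derivative
      ?c * (real (k - 1) * ?p ^ (k - 1 - 1) * exp (- t)) * exp (- t) ^ (n - k + 1)
      - ?c * ?p ^ (k - 1) * (real (n - k + 1) * exp (- t) ^ (n - k + 1))) (at t)"
    unfolding iid_pdf_def[abs_def]
    by (rule derivative_eq_intros refl | simp)+
  also have "real (k - 1) * ?p ^ (k - 1 - 1) = (real k - 1) * (?p ^ (k - 1) / ?p)"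
    using p False by (cases "k - 1") (auto simp: of_nat_diff)
  also have "real (n - k + 1) = real n - real k + 1" using assms by (simp add: of_nat_diff)
  also have "?c * ((real k - 1) * (?p ^ (k - 1) / ?p) * exp (- t)) * exp (- t) ^ (n - k + 1)
      - ?c * ?p ^ (k - 1) * ((real n - real k + 1) * exp (- t) ^ (n - k + 1))
      = ((real k - 1) * (exp (- t) / ?p) - (real n - real k + 1)) * iid_pdf n k t"
    unfolding iid_pdf_def by (rule alg)
  also have "(real k - 1) * (exp (- t) / ?p) - (real n - real k + 1) = iid_elasticity n k t / t"
    using assms by (simp add: iid_elasticity_def diff_divide_distrib flip: b)
  finally show ?thesis by simp
qed

text \<open>
  Write \<open>H\<close> for \<open>iid_cdf n k\<close> and \<open>h\<close> for its density. As a function of \<open>H s\<close>, the quantity \<open>s * h s\<close> has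
  slope \<open>1 + iid_elasticity n k s\<close>, which decreases; so this function is concave and lies below its
  tangent at \<open>H t\<close>. Stating concavity through the tangent avoids the inverse of \<open>H\<close>.
\<close>

lemma iid_tangent:
  assumes "k \<le> n" "0 < t" "0 < s"
  shows "s * iid_pdf n k s \<le> t * iid_pdf n k t
    + (1 + iid_elasticity n k t) * (iid_cdf n k s - iid_cdf n k t)"
proof (cases "k = 0")
  case True
  then show ?thesis by (simp add: iid_pdf_0 iid_cdf_0)
next
  case False
  let ?f = "iid_pdf n k" and ?F = "iid_cdf n k" and ?B = "\<lambda>t. 1 + iid_elasticity n k t"
  define D where "D = (\<lambda>u. u * ?f u - ?B t * ?F u)"
  have der: "(D has_real_derivative (?B u - ?B t) * ?f u) (at u)" if "0 < u" for u
  proof -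
    have "(D has_real_derivative (1 * ?f u + iid_elasticity n k u * ?f u / u * u) - ?B t * ?f u) (at u)"
      unfolding D_def
      by (intro DERIV_diff DERIV_mult DERIV_ident DERIV_cmult DERIV_iid_cdf DERIV_iid_pdf assms that)
    then show ?thesis using that by (simp add: algebra_simps)
  qed
  have fpos: "0 < ?f u" if "0 < u" for u using iid_pdf_pos that False assms by simp
  have cont: "continuous_on {a..b} D" if "0 < a" for a b
    using that by (intro continuous_at_imp_continuous_on ballI DERIV_isCont[OF der]) auto
  have "D s \<le> D t"
  proof (cases "s \<le> t")
    case True
    show ?thesis
    proof (rule DERIV_nonneg_imp_increasing_open[OF True])
      fix u assume u: "s < u" "u < t"
      have "0 \<le> (?B u - ?B t) * ?f u"
        using iid_elasticity_antimono[of k n u t] fpos[of u] False assms u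
        by (intro mult_nonneg_nonneg) auto
      then show "\<exists>y. (D has_real_derivative y) (at u) \<and> 0 \<le> y" using der[of u] u assms by auto
    qed (use cont assms in auto)
  next
    case False
    then have "t \<le> s" by simp
    then show ?thesis
    proof (rule DERIV_nonpos_imp_decreasing_open)
      fix u assume u: "t < u" "u < s"
      have "(?B u - ?B t) * ?f u \<le> 0"
        using iid_elasticity_antimono[of k n t u] fpos[of u] \<open>k \<noteq> 0\<close> assms u
        by (intro mult_nonpos_nonneg) auto
      then show "\<exists>y. (D has_real_derivative y) (at u) \<and> y \<le> 0" using der[of u] u assms by auto
    qed (use cont assms in auto)
  qed
  then show ?thesis unfolding D_def by (simp add: algebra_simps)
qed

section \<open>The density at times of equal probability\<close>

text \<open>
  A positive value at \<open>b\<close> would persist, or be exceeded, everywhere to the left of \<open>b\<close>, since \<open>f\<close>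
  cannot increase where it is positive; this contradicts the limit at 0.
\<close>

lemma nonpos_if_decreasing_where_pos:
  fixes f :: "real \<Rightarrow> real"
  assumes der: "\<And>x. 0 < x \<Longrightarrow> (f has_real_derivative f' x) (at x)"
    and dec: "\<And>x. 0 < x \<Longrightarrow> 0 < f x \<Longrightarrow> f' x \<le> 0"
    and lim: "(f \<longlongrightarrow> 0) (at_right 0)" and "0 < b"
  shows "f b \<le> 0"
proof (rule ccontr)
  assume "\<not> f b \<le> 0"
  then have fb: "0 < f b" by simp
  have "\<forall>\<^sub>F x in at_right 0. f x < f b \<and> 0 < x \<and> x < b"
    using order_tendstoD(2)[OF lim fb] \<open>0 < b\<close>
    by (intro eventually_conj) (auto simp: eventually_at_right_field)
  then obtain a where a: "f a < f b" "0 < a" "a < b"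
    using eventually_happens'[of "at_right (0::real)"] by auto
  define v where "v = max 0 (f a)"
  have v: "0 \<le> v" "f a \<le> v" "v < f b" using a fb by (auto simp: v_def)
  have cont: "continuous_on {s..t} f" if "0 < s" for s t
    using that by (intro continuous_at_imp_continuous_on ballI DERIV_isCont[OF der]) auto
  \<comment> \<open>The last point at which the value is at most v starts an interval on which f is positive.\<close>
  define K where "K = {a..b} \<inter> f -` {..v}"
  have "closed K" unfolding K_def
    by (intro continuous_closed_preimage cont a) auto
  then have "compact (K \<inter> {a..b})" by (intro closed_Int_compact compact_Icc)
  moreover have "K \<inter> {a..b} = K" by (auto simp: K_def)
  ultimately have "compact K" by simp
  moreover have "a \<in> K" using a v by (simp add: K_def)
  then have "K \<noteq> {}" by blast
  ultimately obtain c where c: "c \<in> K" "\<And>x. x \<in> K \<Longrightarrow> x \<le> c"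
    using compact_attains_sup[of K] by auto
  then have c': "a \<le> c" "c \<le> b" "f c \<le> v" by (auto simp: K_def)
  have "f b \<le> f c"
  proof (rule DERIV_nonpos_imp_decreasing_open[OF c'(2)])
    fix x assume x: "c < x" "x < b"
    then have "x \<notin> K" using c by force
    then have "v < f x" using x c' by (auto simp: K_def)
    then show "\<exists>y. (f has_real_derivative y) (at x) \<and> y \<le> 0"
      using der[of x] dec[of x] x c' a v by auto
  qed (use cont a c' in auto)
  then show False using c' v by linarith
qed

definition iid_quantile :: "nat \<Rightarrow> nat \<Rightarrow> real \<Rightarrow> real" where
  "iid_quantile n k v = (THE t. 0 < t \<and> iid_cdf n k t = v)"

lemma iid_cdf_less_iff:
  assumes "1 \<le> k" "k \<le> n" "0 \<le> s" "0 \<le> t"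
  shows "iid_cdf n k s < iid_cdf n k t \<longleftrightarrow> s < t"
  unfolding iid_cdf_def using assms by (intro os_cdf_less_iff) auto

lemma iid_cdf_le_iff:
  assumes "1 \<le> k" "k \<le> n" "0 \<le> s" "0 \<le> t"
  shows "iid_cdf n k s \<le> iid_cdf n k t \<longleftrightarrow> s \<le> t"
  unfolding iid_cdf_def using assms by (intro os_cdf_le_iff) auto

lemma iid_quantile_cdf:
  assumes "1 \<le> k" "k \<le> n" "0 < t"
  shows "iid_quantile n k (iid_cdf n k t) = t"
  unfolding iid_quantile_def
proof (rule the_equality)
  fix s assume "0 < s \<and> iid_cdf n k s = iid_cdf n k t"
  then show "s = t"
    using iid_cdf_less_iff[of k n s t] iid_cdf_less_iff[of k n t s] assms by auto
qed (use assms in auto)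

lemma iid_quantile:
  assumes "1 \<le> k" "k \<le> n" "0 < v" "v < 1"
  shows "0 < iid_quantile n k v" "iid_cdf n k (iid_quantile n k v) = v"
proof -
  obtain t where "0 < t" "iid_cdf n k t = v"
    using os_cdf_surj[of "{..<n}" k "\<lambda>_. 1" v] assms unfolding iid_cdf_def by auto
  then show "0 < iid_quantile n k v" "iid_cdf n k (iid_quantile n k v) = v"
    using iid_quantile_cdf[OF assms(1,2)] by auto
qed

lemma DERIV_iid_quantile:
  assumes "1 \<le> k" "k \<le> n" "0 < v" "v < 1"
  shows "(iid_quantile n k has_real_derivative inverse (iid_pdf n k (iid_quantile n k v))) (at v)"
proof (rule DERIV_inverse_function)
  let ?t = "iid_quantile n k v"
  note t = iid_quantile[OF assms]
  show "(iid_cdf n k has_real_derivative iid_pdf n k ?t) (at ?t)"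
    by (rule DERIV_iid_cdf[OF assms(2)])
  show "iid_pdf n k ?t \<noteq> 0" using iid_pdf_pos[OF assms(1,2) t(1)] by simp
  show "0 < v" "v < 1" by fact+
  show "iid_cdf n k (iid_quantile n k y) = y" if "0 < y" "y < 1" for y
    using iid_quantile(2)[OF assms(1,2) that] .
  have "isCont (iid_quantile n k) (iid_cdf n k ?t)"
  proof (rule isCont_inverse_function[where f = "iid_cdf n k" and d = "?t / 2"])
    show "0 < ?t / 2" using t by simp
    fix z assume "\<bar>z - ?t\<bar> \<le> ?t / 2"
    then have "?t - z \<le> ?t / 2" using abs_ge_minus_self[of "z - ?t"] by linarith
    then have "0 < z" using t(1) by linarith
    then show "iid_quantile n k (iid_cdf n k z) = z" by (rule iid_quantile_cdf[OF assms(1,2)])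
    show "isCont (iid_cdf n k) z" using DERIV_isCont[OF DERIV_iid_cdf[OF assms(2)]] .
  qed
  then show "isCont (iid_quantile n k) v" using t(2) by simp
qed

text \<open>
  The time \<open>\<theta> x\<close> by which \<open>k\<close> lifetimes in a sample with all rates 1 have ended with the same
  probability as \<open>k\<close> lifetimes with rates \<open>r\<close> by time \<open>x\<close>.
\<close>

definition matched_time :: "nat \<Rightarrow> ('i \<Rightarrow> real) \<Rightarrow> 'i set \<Rightarrow> real \<Rightarrow> real" where
  "matched_time k r S x = iid_quantile (card S) k (os_cdf k r S x)"

context
  fixes S :: "'i set" and r :: "'i \<Rightarrow> real" and k :: nat
  assumes S: "finite S" "1 \<le> k" "k \<le> card S" "\<forall>i\<in>S. 0 < r i"
begin

lemma matched_time:
  assumes "0 < x"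
  shows "0 < matched_time k r S x"
    and "iid_cdf (card S) k (matched_time k r S x) = os_cdf k r S x"
  using iid_quantile[OF S(2,3) os_cdf_pos[OF S assms] os_cdf_less_1[OF S less_imp_le[OF assms]]]
  by (auto simp: matched_time_def)

lemma DERIV_matched_time:
  assumes "0 < x"
  shows "(matched_time k r S has_real_derivative
    os_pdf k r S x / iid_pdf (card S) k (matched_time k r S x)) (at x)"
proof -
  have "((\<lambda>x. iid_quantile (card S) k (os_cdf k r S x)) has_real_derivative
    inverse (iid_pdf (card S) k (iid_quantile (card S) k (os_cdf k r S x))) * os_pdf k r S x) (at x)"
    by (rule DERIV_chain2[OF DERIV_iid_quantile DERIV_os_cdf])
      (use S assms os_cdf_pos[OF S] os_cdf_less_1[OF S] in auto)
  then show ?thesis by (simp add: matched_time_def[abs_def] field_simps)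
qed

lemma matched_time_le_mean:
  assumes "0 < x"
  shows "card S * matched_time k r S x \<le> sum r S * x"
proof -
  have ne: "S \<noteq> {}" using S by auto
  then have n: "0 < card S" using S by (simp add: card_gt_0_iff)
  have "0 \<le> sum r S * x / card S"
    using S assms by (intro divide_nonneg_nonneg mult_nonneg_nonneg sum_nonneg) (auto intro: less_imp_le)
  moreover have "iid_cdf (card S) k (matched_time k r S x) \<le> iid_cdf (card S) k (sum r S * x / card S)"
    using os_cdf_le_iid_mean[OF S(1) ne S(4), of x k] matched_time[OF assms] assms by simp
  ultimately have "matched_time k r S x \<le> sum r S * x / card S"
    using iid_cdf_le_iff[OF S(2,3), of "matched_time k r S x" "sum r S * x / card S"]
      matched_time(1)[OF assms] by simp
  then show ?thesis using n by (simp add: field_simps)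
qed

lemma matched_time_tendsto_0: "(matched_time k r S \<longlongrightarrow> 0) (at_right 0)"
proof (rule tendsto_sandwich)
  have n: "0 < real (card S)" using S by linarith
  show "\<forall>\<^sub>F x in at_right 0. 0 \<le> matched_time k r S x"
    using eventually_at_right_less[of 0] by eventually_elim (simp add: matched_time less_imp_le)
  show "\<forall>\<^sub>F x in at_right 0. matched_time k r S x \<le> sum r S * x / card S"
    using eventually_at_right_less[of 0]
    by eventually_elim (use matched_time_le_mean n in \<open>simp add: field_simps\<close>)
  have "((\<lambda>x. sum r S * x / card S) \<longlongrightarrow> sum r S * 0 / card S) (at_right 0)"
    by (intro tendsto_intros) (use n in auto)
  then show "((\<lambda>x. sum r S * x / card S) \<longlongrightarrow> 0) (at_right 0)" by simp
qed simp

text \<open>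
  Let \<open>F\<close> and \<open>h\<close> be the distribution function for the rates \<open>r\<close> and the density for rates 1, let
  \<open>\<theta>\<close> be the matched time, \<open>R\<close> the value of \<open>bernoulli_fun\<close> at \<open>\<theta>\<close>, \<open>L = sum r S\<close> and
  \<open>n = card S\<close>. The claim is that \<open>\<phi> x = x * F' x - \<theta> * h \<theta>\<close> is not positive.

  The derivative of \<open>\<phi>\<close> contains \<open>F''\<close>, that is, by the differential equation for \<open>F\<close>, a weighted
  sum of densities of \<open>(k - 1)\<close>th order statistics of the smaller samples. The hypothesis bounds each
  of them by the same tangent at \<open>\<theta>\<close>, hence also their sum, by quantities that the differential
  equations for \<open>F\<close> and for rates 1 express through \<open>F'\<close> and \<open>h \<theta>\<close>. The result is that
  \<open>x * \<phi>' x\<close> is at most \<open>(1 - R) * (x * F' x - L * x / (n * \<theta>) * (\<theta> * h \<theta>)) - L * x * \<phi> x\<close>.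
  Since \<open>n * \<theta> \<le> L * x\<close> by the comparison with the mean rate, the right-hand side is at most
  \<open>(1 - R - L * x) * \<phi> x\<close>, and \<open>1 - R \<le> \<theta> \<le> L * x\<close>. So \<open>\<phi>\<close> cannot increase where it is positive, and
  it tends to 0 at 0.
\<close>

lemma os_pdf_matched_step:
  assumes IH: "\<And>i x t. i \<in> S \<Longrightarrow> 0 < x \<Longrightarrow> 0 < t \<Longrightarrow>
      x * os_pdf (k - 1) r (S - {i}) x \<le> t * iid_pdf (card S - 1) (k - 1) t
        + (1 + iid_elasticity (card S - 1) (k - 1) t) *
          (os_cdf (k - 1) r (S - {i}) x - iid_cdf (card S - 1) (k - 1) t)"
    and "0 < x"
  shows "x * os_pdf k r S x \<le> matched_time k r S x * iid_pdf (card S) k (matched_time k r S x)"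
proof -
  let ?F = "os_cdf k r S" and ?f = "os_pdf k r S" and ?h = "iid_pdf (card S) k"
    and ?e = "iid_elasticity (card S) k" and ?\<theta> = "matched_time k r S" and ?n = "real (card S)"
    and ?L = "sum r S"
  let ?f' = "\<lambda>x. \<Sum>i\<in>S. r i * (os_pdf (k - 1) r (S - {i}) x - ?f x)"
  define \<phi> where "\<phi> = (\<lambda>x. x * ?f x - ?\<theta> x * ?h (?\<theta> x))"
  define \<phi>' where "\<phi>' = (\<lambda>x. ?f x + x * ?f' x - (1 + ?e (?\<theta> x)) * ?f x)"
  have n: "0 < ?n" "1 \<le> card S" using S by linarith+
  have hpos: "0 < ?h (?\<theta> y)" if "0 < y" for y
    using iid_pdf_pos[OF S(2,3)] matched_time(1)[OF that] by simp
  have der: "(\<phi> has_real_derivative \<phi>' y) (at y)" if "0 < y" for y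
  proof -
    have "(\<phi> has_real_derivative (1 * ?f y + ?f' y * y)
        - (?f y / ?h (?\<theta> y) * ?h (?\<theta> y)
          + ?e (?\<theta> y) * ?h (?\<theta> y) / ?\<theta> y * (?f y / ?h (?\<theta> y)) * ?\<theta> y)) (at y)"
      unfolding \<phi>_def
      by (intro DERIV_diff DERIV_mult DERIV_ident DERIV_os_pdf S(1) DERIV_matched_time that
          DERIV_chain2[OF DERIV_iid_pdf] S(3) matched_time(1))
    moreover have "(1 * ?f y + ?f' y * y)
        - (?f y / ?h (?\<theta> y) * ?h (?\<theta> y)
          + ?e (?\<theta> y) * ?h (?\<theta> y) / ?\<theta> y * (?f y / ?h (?\<theta> y)) * ?\<theta> y) = \<phi>' y"
      using hpos[OF that] matched_time(1)[OF that] by (simp add: \<phi>'_def algebra_simps)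
    ultimately show ?thesis by simp
  qed
  have dec: "\<phi>' y \<le> 0" if y: "0 < y" "0 < \<phi> y" for y
  proof -
    define t where "t = ?\<theta> y"
    define m where "m = y * ?f y"
    define M where "M = t * ?h t"
    define R where "R = bernoulli_fun t"
    define G where "G = (\<Sum>i\<in>S. r i * os_cdf (k - 1) r (S - {i}) y)"
    define G' where "G' = (\<Sum>i\<in>S. r i * os_pdf (k - 1) r (S - {i}) y)"
    define J where "J = iid_cdf (card S - 1) (k - 1) t"
    define j where "j = iid_pdf (card S - 1) (k - 1) t"
    have t: "0 < t" "iid_cdf (card S) k t = ?F y" "?n * t \<le> ?L * y"
      using matched_time[OF y(1)] matched_time_le_mean[OF y(1)] by (simp_all add: t_def)
    have M: "0 < M" using hpos[OF y(1)] t by (simp add: M_def t_def)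
    have R: "R \<le> 1" "1 - t \<le> R" using bernoulli_fun_bounds[OF t(1)] by (auto simp: R_def)
    have B: "iid_elasticity (card S - 1) (k - 1) t = ?e t - R"
      unfolding R_def by (rule iid_elasticity_pred[OF S(2) n(2)])
    have G: "G = ?f y + ?L * ?F y"
      by (simp add: G_def os_pdf_def right_diff_distrib sum_subtractf sum_distrib_right)
    have f': "?f' y = G' - ?L * ?f y"
      by (simp add: G'_def right_diff_distrib sum_subtractf sum_distrib_right)
    have h: "?h t = ?n * (J - ?F y)"
      using iid_pdf_eq_diff[OF S(3), of t] t by (simp add: J_def)
    \<comment> \<open>The derivative of the density for rates 1, once from its differential equation and once from the closed form.\<close>
    have j: "?n * (j - ?h t) = ?e t * ?h t / t"
    proof -
      have "(iid_pdf (card S) k has_real_derivative ?n * (j - ?h t)) (at t)"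
      proof -
        have "((\<lambda>t. ?n * (iid_cdf (card S - 1) (k - 1) t - iid_cdf (card S) k t)) has_real_derivative ?n * (j - ?h t)) (at t)"
          unfolding j_def using S(3)
          by (intro DERIV_cmult DERIV_diff DERIV_iid_cdf) auto
        moreover have "iid_pdf (card S) k =
            (\<lambda>t. ?n * (iid_cdf (card S - 1) (k - 1) t - iid_cdf (card S) k t))"
          using iid_pdf_eq_diff[OF S(3)] by (rule ext)
        ultimately show ?thesis by (simp only:)
      qed
      then show ?thesis using DERIV_iid_pdf[OF S(3) t(1)] DERIV_unique by blast
    qed
    have "y * G' = (\<Sum>i\<in>S. r i * (y * os_pdf (k - 1) r (S - {i}) y))"
      by (simp add: G'_def sum_distrib_left algebra_simps)
    also have "\<dots> \<le> (\<Sum>i\<in>S. r i * (t * j + (1 + (?e t - R)) * (os_cdf (k - 1) r (S - {i}) y - J)))"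
      using IH[OF _ y(1) t(1)] S(4) unfolding B j_def J_def
      by (intro sum_mono mult_left_mono) (auto intro: less_imp_le)
    also have "\<dots> = ?L * (t * j) + (1 + (?e t - R)) * (G - ?L * J)"
      by (simp add: G_def sum_distrib_left sum_distrib_right sum.distrib right_diff_distrib
          sum_subtractf distrib_left mult_ac)
    finally have yG': "y * G' \<le> ?L * (t * j) + (1 + (?e t - R)) * (G - ?L * J)" .
    have J: "J = ?F y + M / (?n * t)" using h n t by (simp add: M_def field_simps)
    have tj: "t * j = M + ?e t * M / (?n * t)" using j n t by (simp add: M_def field_simps)
    have yf: "y * (y * ?f' y) \<le> ?L * y * (M - m) + (1 + (?e t - R)) * m
        - ?L * y * (1 - R) * M / (?n * t)"
    proof -
      have "y * (y * G') \<le> y * (?L * (t * j) + (1 + (?e t - R)) * (G - ?L * J))"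
        using yG' y by (intro mult_left_mono) auto
      then show ?thesis unfolding f' G J tj m_def
        by (simp add: algebra_simps add_divide_distrib diff_divide_distrib)
    qed
    have "y * \<phi>' y = m + y * (y * ?f' y) - (1 + ?e t) * m"
      by (simp add: \<phi>'_def m_def t_def algebra_simps)
    also have "\<dots> \<le> m * (1 - R) - ?L * y * (m - M) - ?L * y * (1 - R) * M / (?n * t)"
      using yf by (simp add: algebra_simps)
    also have "\<dots> \<le> m * (1 - R) - ?L * y * (m - M) - (1 - R) * M"
    proof -
      have "(1 - R) * M * (?n * t) \<le> (1 - R) * M * (?L * y)"
        using t R M by (intro mult_left_mono) auto
      then have "(1 - R) * M \<le> (1 - R) * M * (?L * y) / (?n * t)"
        using n t by (simp add: pos_le_divide_eq)
      then show ?thesis by (simp add: mult_ac)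
    qed
    also have "\<dots> = - (?L * y - (1 - R)) * \<phi> y"
      by (simp add: \<phi>_def m_def M_def t_def algebra_simps)
    also have "\<dots> \<le> 0"
    proof -
      have "1 * t \<le> ?n * t" using n t by (intro mult_right_mono) auto
      then have "0 \<le> ?L * y - (1 - R)" using R t by linarith
      then show ?thesis using y by (intro mult_nonpos_nonneg) auto
    qed
    finally show ?thesis using y by (simp add: mult_le_0_iff)
  qed
  have lim: "(\<phi> \<longlongrightarrow> 0) (at_right 0)"
  proof -
    have f0: "(?f \<longlongrightarrow> ?f 0) (at_right 0)"
      using DERIV_isCont[OF DERIV_os_pdf[OF S(1), of k r 0]]
      by (auto simp: isCont_def intro: filterlim_mono at_le)
    have "isCont ?h 0"
      unfolding iid_pdf_def[abs_def] by (intro continuous_intros)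
    then have "((\<lambda>x. ?h (?\<theta> x)) \<longlongrightarrow> ?h 0) (at_right 0)"
      using isCont_tendsto_compose[OF _ matched_time_tendsto_0] by blast
    then have "(\<phi> \<longlongrightarrow> 0 * ?f 0 - 0 * ?h 0) (at_right 0)"
      unfolding \<phi>_def by (intro tendsto_intros f0 matched_time_tendsto_0)
    then show ?thesis by simp
  qed
  have "\<phi> x \<le> 0"
    using nonpos_if_decreasing_where_pos[of \<phi> \<phi>' x] der dec lim \<open>0 < x\<close> by blast
  then show ?thesis by (simp add: \<phi>_def)
qed

end

text \<open>
  Induction on \<open>k\<close>. It is essential that the bound is stated as a tangent: being linear in the
  distribution function, it survives the mixture over the member that ends first, although the
  matched times of the smaller samples differ from each other.

  At the matched time of \<open>x\<close> the last term vanishes, and \<open>os_pdf_matched\<close> below is what remains. It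
  says that the matched time divided by \<open>x\<close> decreases, that is, the order statistic of the unequal
  sample is larger in the star order than that of an equal one.
\<close>

theorem os_pdf_tangent:
  assumes "finite S" "k \<le> card S" "\<forall>i\<in>S. 0 < r i" "0 < x" "0 < t"
  shows "x * os_pdf k r S x \<le> t * iid_pdf (card S) k t
    + (1 + iid_elasticity (card S) k t) * (os_cdf k r S x - iid_cdf (card S) k t)"
  using assms
proof (induction k arbitrary: S x t)
  case 0
  then show ?case by (simp add: os_pdf_0 os_cdf_0 iid_pdf_0 iid_cdf_0)
next
  case (Suc k)
  have S: "finite S" "1 \<le> Suc k" "Suc k \<le> card S" "\<forall>i\<in>S. 0 < r i" using Suc.prems by auto
  let ?s = "matched_time (Suc k) r S x"
  have "x * os_pdf (Suc k) r S x \<le> ?s * iid_pdf (card S) (Suc k) ?s"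
  proof (rule os_pdf_matched_step[OF S _ \<open>0 < x\<close>])
    fix i x t assume i: "i \<in> S" "0 < (x::real)" "0 < (t::real)"
    then have c: "card (S - {i}) = card S - 1" using S by simp
    show "x * os_pdf (Suc k - 1) r (S - {i}) x \<le> t * iid_pdf (card S - 1) (Suc k - 1) t
        + (1 + iid_elasticity (card S - 1) (Suc k - 1) t) *
          (os_cdf (Suc k - 1) r (S - {i}) x - iid_cdf (card S - 1) (Suc k - 1) t)"
      using Suc.IH[of "S - {i}" x t] i S c by simp
  qed
  also have "\<dots> \<le> t * iid_pdf (card S) (Suc k) t
    + (1 + iid_elasticity (card S) (Suc k) t) * (iid_cdf (card S) (Suc k) ?s - iid_cdf (card S) (Suc k) t)"
    using Suc.prems matched_time(1)[OF S \<open>0 < x\<close>] by (intro iid_tangent) auto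
  finally show ?case using matched_time(2)[OF S \<open>0 < x\<close>] by simp
qed

corollary os_pdf_matched:
  assumes "finite S" "1 \<le> k" "k \<le> card S" "\<forall>i\<in>S. 0 < r i" "0 < x"
  shows "x * os_pdf k r S x \<le> matched_time k r S x * iid_pdf (card S) k (matched_time k r S x)"
  using os_pdf_tangent[OF assms(1,3,4,5) matched_time(1)[OF assms]] matched_time(2)[OF assms] by simp

section \<open>Behaviour at small times\<close>

text \<open>
  Lifetime \<open>i\<close> ends by a small time \<open>x\<close> with probability about \<open>r i * x\<close>, so that the sets \<open>A\<close> with
  more than \<open>k\<close> elements contribute only a higher order. This is where the elementary symmetric
  function comes from.
\<close>

lemma os_cdf_small_time:
  assumes "finite S"
  shows "((\<lambda>x. os_cdf k r S x / x ^ k) \<longlongrightarrow> (\<Sum>A | A \<subseteq> S \<and> card A = k. \<Prod>i\<in>A. r i)) (at_right 0)"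
proof -
  let ?I = "{A. A \<subseteq> S \<and> k \<le> card A}"
  let ?g = "\<lambda>A x. (\<Prod>i\<in>A. (1 - exp (- (r i * x))) / x) * x ^ (card A - k) * (\<Prod>i\<in>S - A. exp (- (r i * x)))"
  have lim_p: "((\<lambda>x. (1 - exp (- (r i * x))) / x) \<longlongrightarrow> r i) (at_right 0)" for i
  proof -
    have "((\<lambda>x. 1 - exp (- (r i * x))) has_real_derivative r i) (at 0)"
      by (auto intro!: derivative_eq_intros)
    then have "((\<lambda>x. (1 - exp (- (r i * x))) / x) \<longlongrightarrow> r i) (at 0)"
      by (simp add: has_field_derivative_iff)
    then show ?thesis by (rule tendsto_mono[OF at_le, rotated]) simp
  qed
  have lim_q: "((\<lambda>x. exp (- (r i * x))) \<longlongrightarrow> exp (- (r i * 0))) (at_right 0)" for i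
    by (intro tendsto_intros)
  have "((\<lambda>x. \<Sum>A\<in>?I. ?g A x) \<longlongrightarrow>
      (\<Sum>A\<in>?I. (\<Prod>i\<in>A. r i) * 0 ^ (card A - k) * (\<Prod>i\<in>S - A. exp (- (r i * 0))))) (at_right 0)"
    by (intro tendsto_sum tendsto_mult tendsto_prod lim_p lim_q tendsto_power tendsto_ident_at)
  also have "(\<Sum>A\<in>?I. (\<Prod>i\<in>A. r i) * 0 ^ (card A - k) * (\<Prod>i\<in>S - A. exp (- (r i * 0))))
      = (\<Sum>A | A \<subseteq> S \<and> card A = k. \<Prod>i\<in>A. r i)"
    using assms by (intro sum.mono_neutral_cong_right) auto
  finally show ?thesis
  proof (rule Lim_transform_eventually)
    show "\<forall>\<^sub>F x in at_right 0. (\<Sum>A\<in>?I. ?g A x) = os_cdf k r S x / x ^ k"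
      using eventually_at_right_less[of 0]
    proof eventually_elim
      case (elim x)
      have "?g A x = ((\<Prod>i\<in>A. 1 - exp (- (r i * x))) * (\<Prod>i\<in>S - A. 1 - (1 - exp (- (r i * x))))) / x ^ k"
        if "A \<in> ?I" for A
        using that elim by (simp add: prod_dividef power_diff)
      then show ?case
        by (simp add: os_cdf_def tail_prob_def sum_divide_distrib)
    qed
  qed
qed

lemma elem_sym_mono_of_os_cdf_le:
  assumes "finite S" "\<forall>\<^sub>F x in at_right 0. os_cdf k r S x \<le> os_cdf k r' S x"
  shows "(\<Sum>A | A \<subseteq> S \<and> card A = k. \<Prod>i\<in>A. r i) \<le> (\<Sum>A | A \<subseteq> S \<and> card A = k. \<Prod>i\<in>A. r' i)"
proof (rule tendsto_le[OF _ os_cdf_small_time[OF assms(1)] os_cdf_small_time[OF assms(1)]])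
  show "\<forall>\<^sub>F x in at_right 0. os_cdf k r S x / x ^ k \<le> os_cdf k r' S x / x ^ k"
    using assms(2) eventually_at_right_less[of 0]
    by eventually_elim (simp add: divide_right_mono)
qed simp

lemma sum_prod_const:
  fixes c :: real
  assumes "finite S"
  shows "(\<Sum>A | A \<subseteq> S \<and> card A = k. \<Prod>i\<in>A. c) = (card S choose k) * c ^ k"
  using n_subsets[OF assms, of k] by simp

section \<open>Density and survival function against those for equal rates\<close>

text \<open>
  The hazard rate for rates 1 increases: survival function divided by density is a combination, with
  nonnegative coefficients, of the powers \<open>((1 - p) / p) ^ (k - 1 - j)\<close> for \<open>j < k\<close>, where
  \<open>p = 1 - exp (- t)\<close> grows with \<open>t\<close>. The proof compares these terms without the quotients.
\<close>

lemma iid_increasing_hazard: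
  assumes "1 \<le> k" "k \<le> n" "0 < s" "s \<le> t"
  shows "iid_pdf n k s * (1 - iid_cdf n k t) \<le> iid_pdf n k t * (1 - iid_cdf n k s)"
proof -
  let ?p = "\<lambda>t. 1 - exp (- t)" and ?q = "\<lambda>t::real. exp (- t)"
  have surv: "1 - iid_cdf n k u = (\<Sum>j<k. real (n choose j) * ?p u ^ j * ?q u ^ (n - j))" for u
    unfolding iid_cdf_def os_cdf_def by (subst one_minus_tail_prob) (auto simp: exact_prob_const)
  have term_le: "?p s ^ (k - 1) * ?q s ^ (n - k + 1) * (?p t ^ j * ?q t ^ (n - j))
      \<le> ?p t ^ (k - 1) * ?q t ^ (n - k + 1) * (?p s ^ j * ?q s ^ (n - j))" if "j < k" for j
  proof -
    have split: "k - 1 = j + (k - 1 - j)" "n - j = (n - k + 1) + (k - 1 - j)" using that assms by auto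
    have alg: "ps ^ (j + d) * qs ^ m * (pt ^ j * qt ^ (m + d)) = (ps * pt) ^ j * (qs * qt) ^ m * (ps * qt) ^ d"
      for ps qs pt qt :: real and d m by (simp add: power_add power_mult_distrib mult_ac)
    have "(?p s * ?q t) ^ (k - 1 - j) \<le> (?p t * ?q s) ^ (k - 1 - j)"
      using assms by (intro power_mono mult_mono) auto
    then have "(?p s * ?p t) ^ j * (?q s * ?q t) ^ (n - k + 1) * (?p s * ?q t) ^ (k - 1 - j)
        \<le> (?p s * ?p t) ^ j * (?q s * ?q t) ^ (n - k + 1) * (?p t * ?q s) ^ (k - 1 - j)"
      using assms by (intro mult_left_mono mult_nonneg_nonneg zero_le_power) auto
    also have "\<dots> = (?p t * ?p s) ^ j * (?q t * ?q s) ^ (n - k + 1) * (?p t * ?q s) ^ (k - 1 - j)"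
      by (simp only: mult.commute)
    finally show ?thesis by (subst (1 2) split(2), subst (1 2) split(1), unfold alg)
  qed
  have "(\<Sum>j<k. real k * real (n choose k) * real (n choose j) *
        (?p s ^ (k - 1) * ?q s ^ (n - k + 1) * (?p t ^ j * ?q t ^ (n - j))))
    \<le> (\<Sum>j<k. real k * real (n choose k) * real (n choose j) *
        (?p t ^ (k - 1) * ?q t ^ (n - k + 1) * (?p s ^ j * ?q s ^ (n - j))))"
    by (intro sum_mono mult_left_mono term_le) auto
  then show ?thesis unfolding surv iid_pdf_def sum_distrib_left by (simp only: mult_ac)
qed

context
  fixes S :: "'i set" and r :: "'i \<Rightarrow> real" and k :: nat
  assumes S: "finite S" "1 \<le> k" "k \<le> card S" "\<forall>i\<in>S. 0 < r i"
begin

lemma matched_time_ratio_antimono: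
  assumes "0 < x" "x \<le> y"
  shows "matched_time k r S y / y \<le> matched_time k r S x / x"
proof (rule DERIV_nonpos_imp_nonincreasing[OF assms(2)])
  let ?\<theta> = "matched_time k r S" and ?h = "iid_pdf (card S) k"
  fix u assume "x \<le> u" "u \<le> y"
  then have u: "0 < u" using assms by simp
  let ?D = "(os_pdf k r S u / ?h (?\<theta> u) * u - ?\<theta> u * 1) / (u * u)"
  have "((\<lambda>u. ?\<theta> u / u) has_real_derivative ?D) (at u)"
    by (intro DERIV_divide DERIV_matched_time[OF S u] DERIV_ident) (use u in auto)
  moreover have "0 < ?h (?\<theta> u)" using iid_pdf_pos[OF S(2,3) matched_time(1)[OF S u]] .
  then have "os_pdf k r S u / ?h (?\<theta> u) * u \<le> ?\<theta> u"
    using os_pdf_matched[OF S u] by (simp add: field_simps)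
  then have "?D \<le> 0" using u by (simp add: divide_nonpos_pos)
  ultimately show "\<exists>d. ((\<lambda>u. ?\<theta> u / u) has_real_derivative d) (at u) \<and> d \<le> 0" by blast
qed

context
  fixes c :: real
  assumes c: "0 < c" "(\<Sum>A | A \<subseteq> S \<and> card A = k. \<Prod>i\<in>A. r i) \<le> (card S choose k) * c ^ k"
begin

text \<open>
  The ratio of matched time and time is largest near 0. If it ever exceeded \<open>c\<close>, then near 0 it would
  be at least some \<open>\<sigma> > c\<close>, and the distribution function at least that for a common rate \<open>\<sigma>\<close>. Then
  the elementary symmetric function would be at least \<open>(card S choose k) * \<sigma> ^ k\<close>, against the assumption.
\<close>

lemma matched_time_le:
  assumes "0 < x"
  shows "matched_time k r S x \<le> c * x"
proof (rule ccontr)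
  assume gt: "\<not> matched_time k r S x \<le> c * x"
  define \<sigma> where "\<sigma> = matched_time k r S x / x"
  have \<sigma>: "c < \<sigma>" using gt assms by (simp add: \<sigma>_def field_simps)
  have "\<forall>\<^sub>F y in at_right 0. 0 < y \<and> y < x"
    using assms by (auto simp: eventually_at_right_field)
  then have "\<forall>\<^sub>F y in at_right 0. os_cdf k (\<lambda>_. \<sigma>) S y \<le> os_cdf k r S y"
  proof eventually_elim
    case (elim y)
    then have "\<sigma> * y \<le> matched_time k r S y"
      using matched_time_ratio_antimono[of y x] by (simp add: \<sigma>_def field_simps)
    moreover have "0 \<le> \<sigma> * y" using elim \<sigma> c by simp
    ultimately have "iid_cdf (card S) k (\<sigma> * y) \<le> iid_cdf (card S) k (matched_time k r S y)"
      using iid_cdf_le_iff[OF S(2,3)] by simp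
    then show ?case using elim by (simp add: os_cdf_const[OF S(1)] matched_time(2)[OF S])
  qed
  then have "(card S choose k) * \<sigma> ^ k \<le> (card S choose k) * c ^ k"
    using elem_sym_mono_of_os_cdf_le[OF S(1), of k "\<lambda>_. \<sigma>" r] c(2) sum_prod_const[OF S(1), where k = k and c = \<sigma>]
    by linarith
  moreover have "c ^ k < \<sigma> ^ k" using \<sigma> c S(2) by (intro power_strict_mono) auto
  moreover have "0 < real (card S choose k)" using S(3) by simp
  ultimately show False by (simp add: mult_le_cancel_left)
qed

lemma os_pdf_le_matched:
  assumes "0 < x"
  shows "os_pdf k r S x \<le> c * iid_pdf (card S) k (matched_time k r S x)"
proof -
  have "x * os_pdf k r S x \<le> matched_time k r S x * iid_pdf (card S) k (matched_time k r S x)"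
    by (rule os_pdf_matched[OF S assms])
  also have "\<dots> \<le> c * x * iid_pdf (card S) k (matched_time k r S x)"
    using matched_time_le[OF assms] iid_pdf_pos[OF S(2,3) matched_time(1)[OF S assms]]
    by (intro mult_right_mono) auto
  finally have "x * os_pdf k r S x \<le> x * (c * iid_pdf (card S) k (matched_time k r S x))"
    by (simp add: mult_ac)
  then show ?thesis using assms by simp
qed

text \<open>
  Up to the factor \<open>c\<close>, the matched time is the map that carries the order statistic of the given sample to
  that of the sample with common rate \<open>c\<close>; this bound is the dispersive order between them.
\<close>

lemma matched_time_lipschitz:
  assumes "0 < x" "x \<le> y"
  shows "matched_time k r S y - matched_time k r S x \<le> c * (y - x)"
proof -
  let ?\<theta> = "matched_time k r S"
  have "?\<theta> y - c * y \<le> ?\<theta> x - c * x"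
  proof (rule DERIV_nonpos_imp_nonincreasing[OF assms(2)])
    fix u assume "x \<le> u" "u \<le> y"
    then have u: "0 < u" using assms by simp
    let ?D = "os_pdf k r S u / iid_pdf (card S) k (?\<theta> u) - c * 1"
    have "((\<lambda>u. ?\<theta> u - c * u) has_real_derivative ?D) (at u)"
      by (intro DERIV_diff DERIV_cmult DERIV_matched_time[OF S u] DERIV_ident)
    moreover have "?D \<le> 0"
      using os_pdf_le_matched[OF u] iid_pdf_pos[OF S(2,3) matched_time(1)[OF S u]]
      by (simp add: field_simps)
    ultimately show "\<exists>d. ((\<lambda>u. ?\<theta> u - c * u) has_real_derivative d) (at u) \<and> d \<le> 0" by blast
  qed
  then show ?thesis by (simp add: algebra_simps)
qed

text \<open>
  The density is at most \<open>c * h \<theta>\<close>, the survival function is that of rates 1 at \<open>\<theta>\<close>, and so the hazard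
  rate at \<open>u\<close> is at most \<open>c\<close> times the hazard rate for rates 1 at \<open>\<theta>\<close>. Since that one increases and
  \<open>\<theta> \<le> c * u\<close>, the bound is at most the hazard rate at \<open>u\<close> for the common rate \<open>c\<close>.
\<close>

lemma survival_ratio_mono:
  assumes "0 < x" "x \<le> y"
  shows "(1 - os_cdf k r S x) / (1 - os_cdf k (\<lambda>_. c) S x)
       \<le> (1 - os_cdf k r S y) / (1 - os_cdf k (\<lambda>_. c) S y)"
  unfolding os_cdf_const[OF S(1)]
proof (rule DERIV_nonneg_imp_nondecreasing[OF assms(2)])
  let ?H = "iid_cdf (card S) k" and ?h = "iid_pdf (card S) k" and ?F = "os_cdf k r S"
    and ?f = "os_pdf k r S"
  fix u assume "x \<le> u" "u \<le> y"
  then have u: "0 < u" using assms by simp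
  let ?\<theta> = "matched_time k r S u"
  have H1: "0 < 1 - ?H (c * u)"
    using os_cdf_less_1[of "{..<card S}" k "\<lambda>_. 1" "c * u"] S c u by (simp add: iid_cdf_def)
  have F1: "0 < 1 - ?F u" using os_cdf_less_1[OF S, of u] u by simp
  let ?D = "((0 - ?f u) * (1 - ?H (c * u)) - (1 - ?F u) * (0 - ?h (c * u) * c))
    / ((1 - ?H (c * u)) * (1 - ?H (c * u)))"
  have chain: "((\<lambda>u. ?H (c * u)) has_real_derivative ?h (c * u) * c) (at u)"
    using DERIV_chain2[OF DERIV_iid_cdf[OF S(3)] DERIV_cmult_Id] by blast
  have "((\<lambda>u. (1 - ?F u) / (1 - ?H (c * u))) has_real_derivative ?D) (at u)"
    using H1 by (intro DERIV_divide DERIV_diff DERIV_const DERIV_os_cdf S(1) chain) auto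
  moreover have "0 \<le> ?D"
  proof -
    have "?f u * (1 - ?H (c * u)) \<le> c * ?h ?\<theta> * (1 - ?H (c * u))"
      using os_pdf_le_matched[OF u] H1 by (intro mult_right_mono) auto
    also have "\<dots> = c * (?h ?\<theta> * (1 - ?H (c * u)))" by simp
    also have "\<dots> \<le> c * (?h (c * u) * (1 - ?H ?\<theta>))"
      using iid_increasing_hazard[OF S(2,3) matched_time(1)[OF S u] matched_time_le[OF u]] c
      by (intro mult_left_mono) auto
    also have "?H ?\<theta> = ?F u" by (rule matched_time(2)[OF S u])
    finally show ?thesis using H1 by (intro divide_nonneg_pos mult_pos_pos) (simp_all add: algebra_simps)
  qed
  ultimately show "\<exists>d. ((\<lambda>u. (1 - ?F u) / (1 - ?H (c * u))) has_real_derivative d) (at u) \<and> 0 \<le> d" by blast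
qed

end

end

section \<open>Distribution functions of order statistics\<close>

lemma sort_nth_le_iff:
  fixes x :: "'a :: linorder"
  assumes "m < length xs"
  shows "sort xs ! m \<le> x \<longleftrightarrow> m < length (filter (\<lambda>y. y \<le> x) xs)"
proof -
  let ?ys = "sort xs"
  have "length (filter (\<lambda>y. y \<le> x) xs) = length (filter (\<lambda>y. y \<le> x) ?ys)"
    by (metis mset_filter mset_sort size_mset)
  also have "\<dots> = card {i. i < length xs \<and> ?ys ! i \<le> x}"
    by (simp add: length_filter_conv_card)
  finally have len: "length (filter (\<lambda>y. y \<le> x) xs) = card {i. i < length xs \<and> ?ys ! i \<le> x}" .
  show ?thesis
  proof
    assume le: "?ys ! m \<le> x"
    have "{..m} \<subseteq> {i. i < length xs \<and> ?ys ! i \<le> x}"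
    proof
      fix i assume "i \<in> {..m}"
      then show "i \<in> {i. i < length xs \<and> ?ys ! i \<le> x}"
        using assms le sorted_nth_mono[of ?ys i m] by auto
    qed
    then have "card {..m} \<le> card {i. i < length xs \<and> ?ys ! i \<le> x}" by (intro card_mono) auto
    then show "m < length (filter (\<lambda>y. y \<le> x) xs)" unfolding len by simp
  next
    assume less: "m < length (filter (\<lambda>y. y \<le> x) xs)"
    show "?ys ! m \<le> x"
    proof (rule ccontr)
      assume gt: "\<not> ?ys ! m \<le> x"
      have "{i. i < length xs \<and> ?ys ! i \<le> x} \<subseteq> {..<m}"
      proof
        fix i assume "i \<in> {i. i < length xs \<and> ?ys ! i \<le> x}"
        then show "i \<in> {..<m}"
          using gt assms sorted_nth_mono[of ?ys m i] by (cases "m \<le> i") auto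
      qed
      then have "card {i. i < length xs \<and> ?ys ! i \<le> x} \<le> card {..<m}" by (intro card_mono) auto
      then show False using less unfolding len by simp
    qed
  qed
qed

lemma order_statistic_le_iff:
  assumes "1 \<le> k" "k \<le> n"
  shows "order_statistic n k X \<omega> \<le> x \<longleftrightarrow> k \<le> card {i \<in> {1..n}. X i \<omega> \<le> x}"
proof -
  have "length (filter (\<lambda>y. y \<le> x) (map (\<lambda>i. X i \<omega>) [1..<Suc n]))
      = card (set (filter (\<lambda>i. X i \<omega> \<le> x) [1..<Suc n]))"
    by (subst distinct_card) (simp_all add: filter_map o_def del: upt_Suc)
  also have "set (filter (\<lambda>i. X i \<omega> \<le> x) [1..<Suc n]) = {i \<in> {1..n}. X i \<omega> \<le> x}" by auto
  finally show ?thesis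
    unfolding order_statistic_def using assms by (subst sort_nth_le_iff) auto
qed

text \<open>
  The event is the disjoint union, over all index sets \<open>A\<close> with at least \<open>k\<close> elements, of the events
  that exactly the variables with index in \<open>A\<close> are at most \<open>x\<close>; their probabilities factorise.
\<close>

lemma (in prob_space) order_statistic_cdf:
  assumes indep: "indep_vars (\<lambda>_. borel) X {1..n}" and k: "1 \<le> k" "k \<le> n"
  shows "cdf (distr M borel (order_statistic n k X)) x
    = tail_prob k (\<lambda>i. \<P>(\<omega> in M. X i \<omega> \<le> x)) {1..n}"
proof -
  have rv: "X i \<in> borel_measurable M" if "i \<in> {1..n}" for i
    using indep that by (auto simp: indep_vars_def)
  define E where "E y A = (\<Inter>i\<in>{1..n}. X i -` (if i \<in> A then {..y} else {y<..}) \<inter> space M)" for y A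
  have E_sets: "E y A \<in> sets M" for y A
    unfolding E_def using k rv by (intro sets.finite_INT measurable_sets[OF rv]) auto
  have E_iff: "\<omega> \<in> E y A \<longleftrightarrow> \<omega> \<in> space M \<and> {i \<in> {1..n}. X i \<omega> \<le> y} = A" if "A \<subseteq> {1..n}" for \<omega> y A
  proof -
    have "\<omega> \<in> E y A \<longleftrightarrow> \<omega> \<in> space M \<and> (\<forall>i\<in>{1..n}. X i \<omega> \<le> y \<longleftrightarrow> i \<in> A)"
    proof -
      have "\<omega> \<in> X i -` (if i \<in> A then {..y} else {y<..}) \<inter> space M \<longleftrightarrow> \<omega> \<in> space M \<and> (X i \<omega> \<le> y \<longleftrightarrow> i \<in> A)"
        for i by (cases "i \<in> A") auto
      moreover have "1 \<in> {1..n}" using k by simp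
      ultimately show ?thesis unfolding E_def INT_iff by blast
    qed
    also have "\<dots> \<longleftrightarrow> \<omega> \<in> space M \<and> {i \<in> {1..n}. X i \<omega> \<le> y} = A" using that by blast
    finally show ?thesis .
  qed
  let ?I = "{A. A \<subseteq> {1..n} \<and> k \<le> card A}"
  have event: "{\<omega> \<in> space M. order_statistic n k X \<omega> \<le> y} = (\<Union>A\<in>?I. E y A)" for y
  proof (intro equalityI subsetI)
    fix \<omega> assume \<omega>: "\<omega> \<in> {\<omega> \<in> space M. order_statistic n k X \<omega> \<le> y}"
    let ?A = "{i \<in> {1..n}. X i \<omega> \<le> y}"
    have "?A \<in> ?I" using \<omega> order_statistic_le_iff[OF k, of X \<omega> y] by auto
    moreover have "\<omega> \<in> E y ?A" using \<omega> by (subst E_iff) auto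
    ultimately show "\<omega> \<in> (\<Union>A\<in>?I. E y A)" by blast
  next
    fix \<omega> assume "\<omega> \<in> (\<Union>A\<in>?I. E y A)"
    then obtain A where "A \<subseteq> {1..n}" "k \<le> card A" "\<omega> \<in> E y A" by blast
    then show "\<omega> \<in> {\<omega> \<in> space M. order_statistic n k X \<omega> \<le> y}"
      using E_iff[of A \<omega> y] order_statistic_le_iff[OF k, of X \<omega> y] by auto
  qed
  have meas: "order_statistic n k X \<in> borel_measurable M"
    unfolding borel_measurable_iff_le event using E_sets by (auto intro: sets.finite_UN)
  have prob_E: "prob (E x A) = (\<Prod>i\<in>A. \<P>(\<omega> in M. X i \<omega> \<le> x)) * (\<Prod>i\<in>{1..n} - A. 1 - \<P>(\<omega> in M. X i \<omega> \<le> x))"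
    if A: "A \<subseteq> {1..n}" for A
  proof -
    have "prob (E x A) = (\<Prod>i\<in>{1..n}. prob (X i -` (if i \<in> A then {..x} else {x<..}) \<inter> space M))"
      unfolding E_def using k by (intro indep_varsD[OF indep]) auto
    also have "\<dots> = (\<Prod>i\<in>{1..n}. if i \<in> A then \<P>(\<omega> in M. X i \<omega> \<le> x) else 1 - \<P>(\<omega> in M. X i \<omega> \<le> x))"
    proof (intro prod.cong refl)
      fix i assume i: "i \<in> {1..n}"
      have "X i -` {..x} \<inter> space M = {\<omega> \<in> space M. X i \<omega> \<le> x}" by auto
      moreover have "X i -` {x<..} \<inter> space M = {\<omega> \<in> space M. \<not> X i \<omega> \<le> x}" by auto
      moreover have "\<P>(\<omega> in M. \<not> X i \<omega> \<le> x) = 1 - \<P>(\<omega> in M. X i \<omega> \<le> x)"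
        using rv[OF i] by (intro prob_neg) measurable
      ultimately show "prob (X i -` (if i \<in> A then {..x} else {x<..}) \<inter> space M)
          = (if i \<in> A then \<P>(\<omega> in M. X i \<omega> \<le> x) else 1 - \<P>(\<omega> in M. X i \<omega> \<le> x))" by simp
    qed
    also have "\<dots> = (\<Prod>i\<in>A. \<P>(\<omega> in M. X i \<omega> \<le> x)) * (\<Prod>i\<in>{1..n} - A. 1 - \<P>(\<omega> in M. X i \<omega> \<le> x))"
      using A by (simp add: prod.If_cases Int_absorb1 Diff_eq)
    finally show ?thesis .
  qed
  have "cdf (distr M borel (order_statistic n k X)) x = prob {\<omega> \<in> space M. order_statistic n k X \<omega> \<le> x}"
    unfolding cdf_def by (subst measure_distr[OF meas]) (simp, simp add: vimage_def Int_def conj_commute)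
  also have "\<dots> = (\<Sum>A\<in>?I. prob (E x A))"
    unfolding event
  proof (rule finite_measure_finite_Union)
    show "disjoint_family_on (E x) ?I"
      using E_iff[of _ _ x] by (fastforce simp only: disjoint_family_on_def mem_Collect_eq disjoint_iff)
    show "E x ` ?I \<subseteq> sets M" using E_sets by blast
  qed simp
  also have "\<dots> = tail_prob k (\<lambda>i. \<P>(\<omega> in M. X i \<omega> \<le> x)) {1..n}"
    unfolding tail_prob_def by (rule sum.cong[OF refl]) (rule prob_E, simp)
  finally show ?thesis .
qed

lemma (in prob_space) exponential_order_statistic_cdf:
  assumes "indep_vars (\<lambda>_. borel) X {1..n}" "1 \<le> k" "k \<le> n" "\<forall>i\<in>{1..n}. 0 < r i"
    and D: "\<And>i. i \<in> {1..n} \<Longrightarrow> distributed M lborel (X i) (exponential_density (r i))"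
  shows "cdf (distr M borel (order_statistic n k X)) x = os_cdf k r {1..n} (max 0 x)"
  unfolding order_statistic_cdf[OF assms(1-3)] os_cdf_def
proof (rule tail_prob_cong)
  fix i assume i: "i \<in> {1..n}"
  have le: "\<P>(\<omega> in M. X i \<omega> \<le> y) = 1 - exp (- (r i * y))" if "0 \<le> y" for y
    using exponential_distributedD_le[OF D[OF i] that] assms(4) i by (simp add: mult.commute)
  show "\<P>(\<omega> in M. X i \<omega> \<le> x) = 1 - exp (- (r i * max 0 x))"
  proof (cases "0 \<le> x")
    case False
    have "X i \<in> borel_measurable M" using assms(1) i by (auto simp: indep_vars_def)
    then have "\<P>(\<omega> in M. X i \<omega> \<le> x) \<le> \<P>(\<omega> in M. X i \<omega> \<le> 0)"
      using False by (intro finite_measure_mono) auto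
    then have "\<P>(\<omega> in M. X i \<omega> \<le> x) = 0" using le[of 0] by (simp add: measure_le_0_iff)
    then show ?thesis using False by simp
  qed (simp add: le)
qed

section \<open>The hazard rate order and the dispersive order\<close>

lemma elem_sym_le_of_os_cdf_le:
  fixes r :: "'i \<Rightarrow> real" and \<gamma> :: real
  assumes "finite S" "\<And>x. 0 < x \<Longrightarrow> os_cdf k r S x \<le> os_cdf k (\<lambda>_. \<gamma>) S x"
  shows "(\<Sum>A | A \<subseteq> S \<and> card A = k. \<Prod>i\<in>A. r i) \<le> (card S choose k) * \<gamma> ^ k"
  unfolding sum_prod_const[OF assms(1), symmetric]
  by (rule elem_sym_mono_of_os_cdf_le[OF assms(1)], use eventually_at_right_less[of 0] in eventually_elim)
    (rule assms(2))

lemma cdf_inv_os_cdf: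
  assumes S: "finite S" "1 \<le> k" "k \<le> card S" "\<forall>i\<in>S. 0 < r i"
    and cdf: "\<And>x. cdf \<mu> x = os_cdf k r S (max 0 x)" and "0 < x"
  shows "cdf_inv \<mu> (os_cdf k r S x) = x"
proof -
  have "{y. os_cdf k r S x < cdf \<mu> y} = {x<..}"
    unfolding cdf using \<open>0 < x\<close> os_cdf_less_iff[OF S, of x] by auto
  then show ?thesis by (simp add: cdf_inv_def)
qed

context
  fixes S :: "'i set" and r :: "'i \<Rightarrow> real" and k :: nat and \<gamma> :: real and \<mu> \<nu> :: "real measure"
  assumes S: "finite S" "1 \<le> k" "k \<le> card S" "\<forall>i\<in>S. 0 < r i"
    and \<gamma>: "0 < \<gamma>"
    and cdf_\<mu>: "\<And>x. cdf \<mu> x = os_cdf k (\<lambda>_. \<gamma>) S (max 0 x)"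
    and cdf_\<nu>: "\<And>x. cdf \<nu> x = os_cdf k r S (max 0 x)"
begin

lemma const_rate_pos: "\<forall>i\<in>S. 0 < (\<lambda>_. \<gamma>) i"
  using \<gamma> by simp

text \<open>
  The ratio of the survival functions increases from its limit 1 at 0.
\<close>

lemma os_cdf_le_of_hr_le:
  assumes "hr_le \<mu> \<nu>" "0 < x"
  shows "os_cdf k r S x \<le> os_cdf k (\<lambda>_. \<gamma>) S x"
proof -
  let ?F = "os_cdf k r S" and ?G = "os_cdf k (\<lambda>_. \<gamma>) S"
  have G1: "0 < 1 - ?G y" if "0 \<le> y" for y
    using os_cdf_less_1[OF S(1-3) const_rate_pos that] by simp
  have at_0: "(os_cdf k q S \<longlongrightarrow> os_cdf k q S 0) (at_right 0)" for q
    using isCont_os_cdf[OF S(1), where k = k and r = q and x = 0]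
    by (auto simp: isCont_def intro: tendsto_mono[OF at_le])
  have "((\<lambda>e. (1 - ?F e) / (1 - ?G e)) \<longlongrightarrow> (1 - ?F 0) / (1 - ?G 0)) (at_right 0)"
    using G1[of 0] by (intro tendsto_intros at_0) auto
  then have lim: "((\<lambda>e. (1 - ?F e) / (1 - ?G e)) \<longlongrightarrow> 1) (at_right 0)"
    by (simp add: os_cdf_at_0[OF S(1,2)])
  have "\<forall>\<^sub>F e in at_right 0. 0 < e \<and> e < x"
    using assms by (auto simp: eventually_at_right_field)
  then have "\<forall>\<^sub>F e in at_right 0. (1 - ?F e) / (1 - ?G e) \<le> (1 - ?F x) / (1 - ?G x)"
  proof eventually_elim
    case (elim e)
    then have "e \<in> {x. 0 < x \<and> cdf \<mu> x < 1}" "x \<in> {x. 0 < x \<and> cdf \<mu> x < 1}"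
      using G1[of e] G1[of x] assms(2) by (auto simp: cdf_\<mu>)
    from mono_onD[OF assms(1)[unfolded hr_le_def] this] elim show ?case
      by (simp add: cdf_\<mu> cdf_\<nu>)
  qed
  from tendsto_upperbound[OF lim this] have "1 \<le> (1 - ?F x) / (1 - ?G x)" by simp
  then show ?thesis using G1[of x] assms(2) by simp
qed

text \<open>
  Both distributions begin at 0, so the dispersive order between a level close to 0 and the level of
  \<open>x\<close> compares the quantiles of that level themselves.
\<close>

lemma os_cdf_le_of_disp_le:
  assumes "disp_le \<mu> \<nu>" "0 < x"
  shows "os_cdf k r S x \<le> os_cdf k (\<lambda>_. \<gamma>) S x"
proof -
  let ?F = "os_cdf k r S" and ?G = "os_cdf k (\<lambda>_. \<gamma>) S"
  have F: "0 < ?F x" "?F x < 1" using os_cdf_pos[OF S] os_cdf_less_1[OF S] assms(2) by auto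
  obtain y where y: "0 < y" "?G y = ?F x"
    using os_cdf_surj[OF S(1-3) const_rate_pos F] by blast
  have "y \<le> x + d" if "0 < d" for d
  proof (cases "d < y")
    case True
    have G: "0 < ?G d" "?G d < ?F x" "?G d < 1"
      using os_cdf_pos[OF S(1-3) const_rate_pos that] y F(2)
        os_cdf_strict_mono[OF S(1-3) const_rate_pos, of d y] True that by auto
    \<comment> \<open>The level of d is the one close to 0.\<close>
    obtain z where z: "0 < z" "?F z = ?G d" using os_cdf_surj[OF S G(1,3)] by blast
    have "cdf_inv \<mu> (?F x) - cdf_inv \<mu> (?G d) \<le> cdf_inv \<nu> (?F x) - cdf_inv \<nu> (?G d)"
      using assms(1) G F unfolding disp_le_def by blast
    moreover have "cdf_inv \<mu> (?F x) = y" "cdf_inv \<mu> (?G d) = d"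
      using cdf_inv_os_cdf[OF S(1-3) const_rate_pos cdf_\<mu>] y that by metis+
    moreover have "cdf_inv \<nu> (?F x) = x" "cdf_inv \<nu> (?G d) = z"
      using cdf_inv_os_cdf[OF S cdf_\<nu>] z assms(2) by metis+
    ultimately show ?thesis using z by simp
  qed (use assms in simp)
  then have "y \<le> x" by (rule field_le_epsilon)
  then show ?thesis
    using os_cdf_le_iff[OF S(1-3) const_rate_pos, of y x] y assms(2) by simp
qed

context
  assumes le: "(\<Sum>A | A \<subseteq> S \<and> card A = k. \<Prod>i\<in>A. r i) \<le> (card S choose k) * \<gamma> ^ k"
begin

lemma hr_le_of_elem_sym_le: "hr_le \<mu> \<nu>"
  unfolding hr_le_def
  using survival_ratio_mono[OF S \<gamma> le]
  by (intro mono_onI) (simp add: cdf_\<mu> cdf_\<nu>)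

lemma disp_le_of_elem_sym_le: "disp_le \<mu> \<nu>"
  unfolding disp_le_def
proof (intro allI impI, elim conjE)
  fix u v :: real assume uv: "0 < u" "u < v" "v < 1"
  let ?\<theta> = "matched_time k r S"
  have inv_\<nu>: "cdf_inv \<nu> (os_cdf k r S x) = x" if "0 < x" for x
    by (rule cdf_inv_os_cdf[OF S cdf_\<nu> that])
  have inv_\<mu>: "cdf_inv \<mu> (os_cdf k r S x) = ?\<theta> x / \<gamma>" if "0 < x" for x
  proof -
    have "0 < ?\<theta> x / \<gamma>" using matched_time(1)[OF S that] \<gamma> by simp
    from cdf_inv_os_cdf[OF S(1-3) const_rate_pos cdf_\<mu> this] show ?thesis
      using \<gamma> matched_time(2)[OF S that] by (simp add: os_cdf_const[OF S(1)])
  qed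
  obtain a where a: "0 < a" "os_cdf k r S a = u" using os_cdf_surj[OF S, of u] uv by auto
  obtain b where b: "0 < b" "os_cdf k r S b = v" using os_cdf_surj[OF S, of v] uv by auto
  have "a \<le> b" using os_cdf_le_iff[OF S, of a b] a b uv by simp
  from matched_time_lipschitz[OF S \<gamma> le a(1) this]
  have "?\<theta> b / \<gamma> - ?\<theta> a / \<gamma> \<le> b - a" using \<gamma> by (simp add: field_simps)
  then show "cdf_inv \<mu> v - cdf_inv \<mu> u \<le> cdf_inv \<nu> v - cdf_inv \<nu> u"
    using inv_\<mu>[OF a(1)] inv_\<mu>[OF b(1)] inv_\<nu>[OF a(1)] inv_\<nu>[OF b(1)] a b by simp
qed

end

lemma hr_le_iff_elem_sym_le:
  "hr_le \<mu> \<nu> \<longleftrightarrow> (\<Sum>A | A \<subseteq> S \<and> card A = k. \<Prod>i\<in>A. r i) \<le> (card S choose k) * \<gamma> ^ k"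
proof
  assume "hr_le \<mu> \<nu>"
  then show "(\<Sum>A | A \<subseteq> S \<and> card A = k. \<Prod>i\<in>A. r i) \<le> (card S choose k) * \<gamma> ^ k"
    by (intro elem_sym_le_of_os_cdf_le[OF S(1)] os_cdf_le_of_hr_le)
qed (rule hr_le_of_elem_sym_le)

lemma disp_le_iff_elem_sym_le:
  "disp_le \<mu> \<nu> \<longleftrightarrow> (\<Sum>A | A \<subseteq> S \<and> card A = k. \<Prod>i\<in>A. r i) \<le> (card S choose k) * \<gamma> ^ k"
proof
  assume "disp_le \<mu> \<nu>"
  then show "(\<Sum>A | A \<subseteq> S \<and> card A = k. \<Prod>i\<in>A. r i) \<le> (card S choose k) * \<gamma> ^ k"
    by (intro elem_sym_le_of_os_cdf_le[OF S(1)] os_cdf_le_of_disp_le)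
qed (rule disp_le_of_elem_sym_le)

end

theorem theorem1:
  fixes M :: "'a measure" and N :: "'b measure"
    and X :: "nat \<Rightarrow> 'a \<Rightarrow> real" and Y :: "nat \<Rightarrow> 'b \<Rightarrow> real"
    and rate :: "nat \<Rightarrow> real" and \<gamma> :: real and n k :: nat
  assumes "1 \<le> n" and "1 \<le> k" and "k \<le> n"
    and "\<And>i. i \<in> {1..n} \<Longrightarrow> 0 < rate i" and "0 < \<gamma>"
    and "prob_space M" and "prob_space N"
    and "prob_space.indep_vars M (\<lambda>_. borel) X {1..n}"
    and "\<And>i. i \<in> {1..n} \<Longrightarrow> distributed M lborel (X i) (exponential_density (rate i))"
    and "prob_space.indep_vars N (\<lambda>_. borel) Y {1..n}"
    and "\<And>i. i \<in> {1..n} \<Longrightarrow> distributed N lborel (Y i) (exponential_density \<gamma>)"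
  shows "(\<gamma> \<ge> root k (inverse (real (n choose k)) * elem_sym n k rate)
           \<longleftrightarrow> hr_le (distr N borel (order_statistic n k Y)) (distr M borel (order_statistic n k X)))
       \<and> (hr_le (distr N borel (order_statistic n k Y)) (distr M borel (order_statistic n k X))
           \<longleftrightarrow> disp_le (distr N borel (order_statistic n k Y)) (distr M borel (order_statistic n k X)))"
proof -
  have S: "finite {1..n}" "k \<le> card {1..n}" "\<forall>i\<in>{1..n}. 0 < rate i"
    using assms(3,4) by auto
  have cdf_X: "cdf (distr M borel (order_statistic n k X)) x = os_cdf k rate {1..n} (max 0 x)" for x
    by (rule prob_space.exponential_order_statistic_cdf[OF assms(6,8,2,3) S(3) assms(9)])
  have cdf_Y: "cdf (distr N borel (order_statistic n k Y)) x = os_cdf k (\<lambda>_. \<gamma>) {1..n} (max 0 x)" for x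
    using prob_space.exponential_order_statistic_cdf[OF assms(7,10,2,3), of "\<lambda>_. \<gamma>"] assms(5,11) by blast
  note iffs = hr_le_iff_elem_sym_le[OF S(1) assms(2) S(2,3) assms(5) cdf_Y cdf_X]
    disp_le_iff_elem_sym_le[OF S(1) assms(2) S(2,3) assms(5) cdf_Y cdf_X]
  have "root k (inverse (real (n choose k)) * elem_sym n k rate) \<le> \<gamma>
      \<longleftrightarrow> root k (inverse (real (n choose k)) * elem_sym n k rate) \<le> root k (\<gamma> ^ k)"
    using assms(2,5) by (simp add: real_root_power_cancel)
  also have "\<dots> \<longleftrightarrow> inverse (real (n choose k)) * elem_sym n k rate \<le> \<gamma> ^ k"
    using assms(2) by (intro real_root_le_iff) simp
  also have "\<dots> \<longleftrightarrow> elem_sym n k rate \<le> real (n choose k) * \<gamma> ^ k"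
    using assms(3) by (simp add: field_simps)
  finally show ?thesis using iffs by (simp add: elem_sym_def)
qed

end
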